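(* Let $p\in(1,\infty)$, $p'=p/(p-1)$, $\alpha\in(0,2)$, and let $K$ be a compact subset of $\mathbb{R}^{n+1}_+$. Let $\mathcal M_+(K)$ be the class of nonnegative Radon measures supported on $K$, and write $\|\mu\|_1=\mu(K)$ for $\mu\in\mathcal M_+(K)$. Then: (i) $$C^{\alpha,p}_{\mathbb{R}^{n+1}_+}(K)=\sup\left\{\|\mu\|_1^p:\ \mu\in\mathcal M_+(K)\ \text{and}\ \|P^*_\alpha\mu\|_{L^{p'}(\mathbb{R}^n)}\le 1\right\}.$$ (ii) There exists a measure $\mu_K\in\mathcal M_+(K)$ such that $$\mu_K(K)=\int_{\mathbb{R}^n}(P^*_\alpha\mu_K(x))^{p'}\,dx=\int_{\mathbb{R}^{n+1}_+}P_\alpha\big((P^*_\alpha\mu_K)^{p'-1}\big)\,d\mu_K=C^{\alpha,p}_{\mathbb{R}^{n+1}_+}(K).$$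
   Context: $\mathbb{R}^{n+1}_+:=\mathbb{R}^n\times(0,\infty)$, $n\ge1$. For $\alpha\in(0,2)$ the Caffarelli-Silvestre Poisson kernel is $p^\alpha_t(x)=c(n,\alpha)\,t^\alpha(|x|^2+t^2)^{-(n+\alpha)/2}$ with $c(n,\alpha)=\frac{\Gamma((n+\alpha)/2)}{\pi^{n/2}\Gamma(\alpha/2)}$ (so that $\int_{\mathbb{R}^n}p^\alpha_t(x)\,dx=1$), and $P_\alpha f(x,t)=\int_{\mathbb{R}^n}p^\alpha_t(x-y)f(y)\,dy$ for $(x,t)\in\mathbb{R}^{n+1}_+$. For a Borel measure $\mu$ with compact support in $\mathbb{R}^{n+1}_+$, $P^*_\alpha\mu(x):=\int_{\mathbb{R}^{n+1}_+}p^\alpha_t(x-z)\,d\mu(z,t)$, $x\in\mathbb{R}^n$. The $L^p$-capacity is $C^{\alpha,p}_{\mathbb{R}^{n+1}_+}(E):=\inf\{\|f\|^p_{L^p(\mathbb{R}^n)}:\ f\ge0,\ P_\alpha f(x,t)\ge1\text{ for all }(x,t)\in E\}$ for $E\subset\mathbb{R}^{n+1}_+$. *)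

theory Defs
  imports "HOL-Analysis.Analysis"
begin

text \<open>
  The dimension \<open>n \<ge> 1\<close> is \<open>CARD('n)\<close>, and points of \<open>\<real>\<^sup>n \<times> \<real>\<close> are pairs \<open>(x, t)\<close>.  All functions
  involved are nonnegative, so integrals, norms and capacities take values in \<open>[0, \<infinity>]\<close>
  and no integrability side conditions are hidden in the integral notation.
\<close>

definition half_space :: "((real ^ 'n) \<times> real) set" where
  "half_space = UNIV \<times> {0<..}"

text \<open>Powers of elements of \<open>[0, \<infinity>]\<close>; only positive real exponents are used below.\<close>

definition epowr :: "ennreal \<Rightarrow> real \<Rightarrow> ennreal" where
  "epowr x r = (if x = \<infinity> then \<infinity> else ennreal (enn2real x powr r))"

definition Lp_norm :: "real \<Rightarrow> ((real ^ 'n) \<Rightarrow> ennreal) \<Rightarrow> ennreal" where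
  "Lp_norm p g = epowr (\<integral>\<^sup>+ x. epowr (g x) p \<partial>lebesgue) (1 / p)"

definition poisson_const :: "nat \<Rightarrow> real \<Rightarrow> real" where
  "poisson_const n \<alpha> =
     Gamma ((real n + \<alpha>) / 2) / (pi powr (real n / 2) * Gamma (\<alpha> / 2))"

definition poisson_kernel :: "real \<Rightarrow> real \<Rightarrow> real ^ 'n \<Rightarrow> real" where
  "poisson_kernel \<alpha> t x =
     poisson_const CARD('n) \<alpha> * t powr \<alpha> * ((norm x)\<^sup>2 + t\<^sup>2) powr (- (real CARD('n) + \<alpha>) / 2)"

definition poisson_ext ::
  "real \<Rightarrow> ((real ^ 'n) \<Rightarrow> ennreal) \<Rightarrow> (real ^ 'n) \<times> real \<Rightarrow> ennreal" where
  "poisson_ext \<alpha> f = (\<lambda>(x, t). \<integral>\<^sup>+ y. ennreal (poisson_kernel \<alpha> t (x - y)) * f y \<partial>lebesgue)"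

text \<open>Restricting to the half-space in the adjoint avoids junk values of the kernel at \<open>t \<le> 0\<close>.\<close>

definition poisson_adj ::
  "real \<Rightarrow> ((real ^ 'n) \<times> real) measure \<Rightarrow> real ^ 'n \<Rightarrow> ennreal" where
  "poisson_adj \<alpha> \<mu> x =
     (\<integral>\<^sup>+ zt\<in>half_space. ennreal (poisson_kernel \<alpha> (snd zt) (x - fst zt)) \<partial>\<mu>)"

text \<open>
  The competitors \<open>f\<close> need not be assumed to lie in \<open>L\<^sup>p\<close>: others contribute the value \<open>\<infinity>\<close> to
  the infimum.
\<close>

definition Lp_capacity :: "real \<Rightarrow> real \<Rightarrow> ((real ^ 'n) \<times> real) set \<Rightarrow> ennreal" where
  "Lp_capacity \<alpha> p E =
     Inf {epowr (Lp_norm p (\<lambda>x. ennreal (f x))) p | f :: real ^ 'n \<Rightarrow> real.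
            f \<in> borel_measurable lebesgue \<and> (\<forall>x. 0 \<le> f x) \<and>
            (\<forall>(x, t) \<in> E. 1 \<le> poisson_ext \<alpha> (\<lambda>y. ennreal (f y)) (x, t))}"

definition radon_measure :: "'a :: topological_space measure \<Rightarrow> bool" where
  "radon_measure \<mu> \<longleftrightarrow>
     sets \<mu> = sets borel \<and>
     (\<forall>C. compact C \<longrightarrow> emeasure \<mu> C < \<infinity>) \<and>
     (\<forall>B \<in> sets borel. emeasure \<mu> B = (SUP C \<in> {C. C \<subseteq> B \<and> compact C}. emeasure \<mu> C))"

text \<open>
  A measure supported on \<open>K\<close> is represented as a measure on the whole ambient space for which
  the complement of \<open>K\<close> is a null set.
\<close>

definition radon_on :: "'a :: topological_space set \<Rightarrow> 'a measure set" where
  "radon_on K = {\<mu>. radon_measure \<mu> \<and> emeasure \<mu> (- K) = 0}"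

end

theory Submission
  imports Defs "HOL-Probability.Probability"
begin

text \<open>
  The extremal measure is found by the direct method.  Let \<open>\<nu>\<close> minimise the energy
  \<open>\<integral> (P\<^sup>* \<nu>)\<^bsup>p'\<^esup>\<close> over the probability measures on a nonempty \<open>K\<close>; it exists because these
  measures are weakly sequentially compact and the energy is lower semicontinuous by Fatou's lemma.
  Let \<open>A > 0\<close> be its energy.  Comparing \<open>\<nu>\<close> with its mixtures with point masses yields
  \<open>P ((P\<^sup>* \<nu>)\<^bsup>p' - 1\<^esup>) \<ge> A\<close> on \<open>K\<close>, so \<open>(P\<^sup>* \<nu>)\<^bsup>p' - 1\<^esup> / A\<close> is admissible and the capacity is
  at most \<open>A\<^bsup>1 - p\<^esup>\<close>.  Conversely Fubini and Hoelder bound the supremum by the capacity, and a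
  multiple of \<open>\<nu>\<close> shows that the supremum is at least \<open>A\<^bsup>1 - p\<^esup>\<close>.  The measure in the second part is
  \<open>A\<^bsup>1 - p\<^esup> \<nu>\<close>.

  Weak compactness of the probability measures on \<open>K\<close> is reduced to Helly's theorem on the real
  line: \<open>K\<close> is a continuous image of a compact set of reals, and measures lift along a Borel section.
\<close>

section \<open>Compact sets as continuous images of compact sets of reals\<close>

text \<open>The Weierstrass M-test applies: a partial sum depends on finitely many bits, and reading
  a bit is continuous for the product topology. The index map \<open>h\<close> selects the bits that
  are read, so that several series can share one bit sequence.\<close>

lemma continuous_on_bool_series:
  fixes c :: "nat \<Rightarrow> real"
  assumes "summable (\<lambda>j. \<bar>c j\<bar>)"
  shows "continuous_on UNIV (\<lambda>b :: nat \<Rightarrow> bool. \<Sum>j. c j * of_bool (b (h j)))"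
proof -
  have "uniform_limit UNIV (\<lambda>n (b :: nat \<Rightarrow> bool). \<Sum>j<n. c j * of_bool (b (h j)))
          (\<lambda>b. \<Sum>j. c j * of_bool (b (h j))) sequentially"
    by (rule Weierstrass_m_test[where M = "\<lambda>j. \<bar>c j\<bar>"]) (use assms in \<open>auto simp: abs_mult\<close>)
  moreover have "continuous_on UNIV (\<lambda>b :: nat \<Rightarrow> bool. \<Sum>j<n. c j * of_bool (b (h j)))" for n
  proof -
    have "continuous_on UNIV (\<lambda>b :: nat \<Rightarrow> bool. (of_bool (b i) :: real))" for i
    proof -
      have "continuous_on UNIV (\<lambda>b :: nat \<Rightarrow> bool. b i)"
        by (rule continuous_on_product_coordinates)
      then show ?thesis
        by (rule continuous_on_compose2[rotated, where t = UNIV and g = of_bool]) auto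
    qed
    then show ?thesis
      by (intro continuous_intros)
  qed
  ultimately show ?thesis
    by (intro uniform_limit_theorem[where F = sequentially]) auto
qed

text \<open>Tychonoff's theorem for a product of two-point spaces.\<close>

lemma compact_UNIV_bool_seq: "compact (UNIV :: (nat \<Rightarrow> bool) set)"
proof -
  have "compact_space (product_topology (\<lambda>_::nat. euclidean :: bool topology) UNIV)"
    unfolding compact_space_product_topology
    by (simp add: compact_space_def compactin_euclidean_iff finite_imp_compact)
  then show ?thesis
    by (simp add: euclidean_product_topology compact_space_def compactin_euclidean_iff)
qed

text \<open>Up to the factor 2/3 this is the usual parametrisation of the Cantor set. Ratio 1/3 in
  place of 1/2 makes it injective, which binary expansions are not.\<close>

definition cantor_real :: "(nat \<Rightarrow> bool) \<Rightarrow> real" where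
  "cantor_real b = (\<Sum>j. (1/3) ^ j * of_bool (b j))"

lemma summable_cantor: "summable (\<lambda>j. (1/3 :: real) ^ j * of_bool (b j))"
  by (rule summable_comparison_test'[where g = "\<lambda>j. (1/3) ^ j" and N = 0])
     (auto simp: summable_geometric)

lemma cantor_real_Suc: "cantor_real b = of_bool (b 0) + cantor_real (b \<circ> Suc) / 3"
proof -
  have "cantor_real b = of_bool (b 0) + (\<Sum>j. (1/3) * ((1/3) ^ j * of_bool (b (Suc j))))"
    unfolding cantor_real_def using suminf_split_head[OF summable_cantor, of b] by (simp add: mult_ac)
  then show ?thesis
    using suminf_mult[OF summable_cantor[of "b \<circ> Suc"], of "1/3"]
    by (simp add: cantor_real_def o_def)
qed

lemma cantor_real_bounds: "0 \<le> cantor_real b" "cantor_real b \<le> 3/2"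
proof -
  show "0 \<le> cantor_real b"
    unfolding cantor_real_def by (rule suminf_nonneg[OF summable_cantor]) auto
  have "cantor_real b \<le> (\<Sum>j. (1/3) ^ j)"
    unfolding cantor_real_def by (rule suminf_le[OF _ summable_cantor]) auto
  then show "cantor_real b \<le> 3/2"
    by (simp add: suminf_geometric)
qed

text \<open>The terms after the leading bit sum to at most 1/2, which is less than 1, so the value
  determines the leading bit. Induction then treats the shifted sequences.\<close>

lemma inj_cantor_real: "inj cantor_real"
proof (rule injI)
  fix b b' assume "cantor_real b = cantor_real b'"
  then have "b n = b' n" for n
  proof (induction n arbitrary: b b')
    have 0: "b 0 = b' 0" and "cantor_real (b \<circ> Suc) = cantor_real (b' \<circ> Suc)"
      if "cantor_real b = cantor_real b'" for b b'
      using that cantor_real_Suc[of b] cantor_real_Suc[of b'] cantor_real_bounds[of "b \<circ> Suc"]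
        cantor_real_bounds[of "b' \<circ> Suc"]
      by (auto simp: of_bool_def split: if_splits)
    {
      case 0
      then show ?case using \<open>\<And>b b'. cantor_real b = cantor_real b' \<Longrightarrow> b 0 = b' 0\<close> by blast
    next
      case (Suc n)
      then show ?case
        using \<open>\<And>b b'. cantor_real b = cantor_real b' \<Longrightarrow> cantor_real (b \<circ> Suc) = cantor_real (b' \<circ> Suc)\<close>
        by (metis comp_apply)
    }
  qed
  then show "b = b'" by auto
qed

text \<open>The digits are the parities of the integers
  \<open>\<lfloor>2 ^ Suc j * x\<rfloor>\<close>. With this choice the partial sums are exactly the
  dyadic roundings of \<open>x\<close> from below, which converge to \<open>x\<close>.\<close>

lemma binary_expansion:
  fixes x :: real
  assumes "0 \<le> x" "x < 1"
  shows "\<exists>b :: nat \<Rightarrow> bool. (\<Sum>j. (1/2) ^ Suc j * of_bool (b j)) = x"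
proof -
  define b where "b j = odd \<lfloor>2 ^ Suc j * x\<rfloor>" for j
  have partial: "(\<Sum>j<m. (1/2) ^ Suc j * of_bool (b j)) = \<lfloor>2 ^ m * x\<rfloor> / 2 ^ m" for m
  proof (induction m)
    case 0
    have "\<lfloor>x\<rfloor> = 0" using assms by linarith
    then show ?case by simp
  next
    case (Suc m)
    have "\<lfloor>2 ^ Suc m * x\<rfloor> = 2 * \<lfloor>2 ^ m * x\<rfloor> + of_bool (b m)"
    proof -
      have "\<lfloor>2 ^ Suc m * x\<rfloor> div 2 = \<lfloor>2 ^ m * x\<rfloor>"
        using floor_divide_real_eq_div[of 2 "2 ^ Suc m * x"] by simp
      then show ?thesis
        using mult_div_mod_eq[of 2 "\<lfloor>2 ^ Suc m * x\<rfloor>"] by (auto simp: b_def mod2_eq_if split: if_splits)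
    qed
    then show ?case
      using Suc by (simp add: field_simps)
  qed
  have "(\<lambda>m. \<lfloor>2 ^ m * x\<rfloor> / 2 ^ m) \<longlonglongrightarrow> x"
  proof (rule real_tendsto_sandwich)
    have "(2 ^ m * x - 1) / 2 ^ m \<le> \<lfloor>2 ^ m * x\<rfloor> / 2 ^ m" for m
      by (intro divide_right_mono) (linarith | simp)+
    then show "\<forall>\<^sub>F m in sequentially. x - (1/2) ^ m \<le> \<lfloor>2 ^ m * x\<rfloor> / 2 ^ m"
      by (auto simp: diff_divide_distrib power_divide)
    have "\<lfloor>2 ^ m * x\<rfloor> / 2 ^ m \<le> (2 ^ m * x) / 2 ^ m" for m
      by (intro divide_right_mono) (linarith | simp)+
    then show "\<forall>\<^sub>F m in sequentially. \<lfloor>2 ^ m * x\<rfloor> / 2 ^ m \<le> x"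
      by auto
    have "(\<lambda>m. x - (1/2) ^ m) \<longlonglongrightarrow> x - 0"
      by (intro tendsto_intros LIMSEQ_realpow_zero) auto
    then show "(\<lambda>m. x - (1/2) ^ m) \<longlonglongrightarrow> x" by simp
  qed auto
  then have "(\<lambda>j. (1/2) ^ Suc j * of_bool (b j)) sums x"
    unfolding sums_def partial .
  then show ?thesis
    by (auto simp: sums_iff)
qed

text \<open>One bit sequence encodes the binary digits of all coordinates of a point, and the space
  of bit sequences sits in the real line as a Cantor set. \<open>C\<close> is the part of that set
  which lands in \<open>K\<close>.\<close>

lemma compact_image_of_real_compact:
  fixes K :: "'a :: euclidean_space set"
  assumes "compact K"
  obtains C :: "real set" and \<phi> where "compact C" "continuous_on C \<phi>" "\<phi> ` C = K"
proof -
  \<comment> \<open>The strict bound puts the rescaled coordinates into the half-open unit interval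
    that \<open>binary_expansion\<close> requires.\<close>
  obtain a where a: "a > 0" "\<And>x. x \<in> K \<Longrightarrow> norm x < a"
    using compact_imp_bounded[OF assms] by (auto simp: bounded_pos_less)
  define N where "N = to_nat_on (Basis :: 'a set)"
  have N: "inj_on N Basis"
    unfolding N_def by (rule inj_on_to_nat_on) (simp add: countable_finite)
  \<comment> \<open>Through \<open>prod_encode\<close> each coordinate owns an infinite set of bits,
    disjoint from those of the other coordinates.\<close>
  define \<beta> where "\<beta> i b = (\<Sum>j. (1/2 :: real) ^ Suc j * of_bool (b (prod_encode (N i, j))))"
    for i and b :: "nat \<Rightarrow> bool"
  define \<psi> where "\<psi> b = (\<Sum>i\<in>Basis. (2 * a * \<beta> i b - a) *\<^sub>R i)" for b
  have summ: "summable (\<lambda>j. \<bar>(1/2 :: real) ^ Suc j\<bar>)"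
    by (simp add: summable_mult summable_geometric power_abs)
  have \<beta>: "continuous_on UNIV (\<beta> i)" for i
    unfolding \<beta>_def by (rule continuous_on_bool_series[OF summ])
  have \<psi>: "continuous_on UNIV \<psi>"
    unfolding \<psi>_def by (intro continuous_intros \<beta>)
  have surj: "\<exists>b. \<psi> b = x" if "x \<in> K" for x
  proof -
    have "\<exists>d :: nat \<Rightarrow> bool. (\<Sum>j. (1/2) ^ Suc j * of_bool (d j)) = (x \<bullet> i + a) / (2 * a)"
      if "i \<in> Basis" for i
    proof (rule binary_expansion)
      have "\<bar>x \<bullet> i\<bar> < a"
        using Basis_le_norm[OF that, of x] a(2)[OF \<open>x \<in> K\<close>] by simp
      then show "0 \<le> (x \<bullet> i + a) / (2 * a)" "(x \<bullet> i + a) / (2 * a) < 1"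
        using a(1) by (auto simp: field_simps abs_less_iff)
    qed
    then obtain d :: "'a \<Rightarrow> nat \<Rightarrow> bool" where
      d: "\<And>i. i \<in> Basis \<Longrightarrow> (\<Sum>j. (1/2) ^ Suc j * of_bool (d i j)) = (x \<bullet> i + a) / (2 * a)"
      by metis
    define b where "b n = (case prod_decode n of (k, j) \<Rightarrow> d (inv_into Basis N k) j)" for n
    have "\<beta> i b = (x \<bullet> i + a) / (2 * a)" if "i \<in> Basis" for i
      using d[OF that] that N by (simp add: \<beta>_def b_def)
    then have "\<psi> b = (\<Sum>i\<in>Basis. (x \<bullet> i) *\<^sub>R i)"
      unfolding \<psi>_def using a(1) by (intro sum.cong) auto
    then show ?thesis by (auto simp: euclidean_representation)
  qed
  have cantor: "continuous_on UNIV cantor_real"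
    unfolding cantor_real_def using continuous_on_bool_series[of "\<lambda>j. (1/3) ^ j" id]
    by (simp add: summable_geometric power_abs)
  have C0: "compact (range cantor_real)"
    by (rule compact_continuous_image[OF cantor compact_UNIV_bool_seq])
  \<comment> \<open>A continuous injection of a compact space into a Hausdorff space has a
    continuous inverse on its range.\<close>
  have "continuous_on (range cantor_real) (inv cantor_real)"
    by (rule continuous_on_inv[OF cantor compact_UNIV_bool_seq]) (simp add: inj_cantor_real)
  then have \<phi>: "continuous_on (range cantor_real) (\<psi> \<circ> inv cantor_real)"
    by (rule continuous_on_compose) (rule continuous_on_subset[OF \<psi>], simp)
  let ?C = "range cantor_real \<inter> (\<psi> \<circ> inv cantor_real) -` K"
  show thesis
  proof
    show "compact ?C"
      using continuous_closed_preimage[OF \<phi> compact_imp_closed[OF C0] compact_imp_closed[OF assms]]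
        C0 by (metis compact_Int_closed inf.absorb_iff2 inf_le1 inf_commute)
    show "continuous_on ?C (\<psi> \<circ> inv cantor_real)"
      by (rule continuous_on_subset[OF \<phi>]) auto
    show "(\<psi> \<circ> inv cantor_real) ` ?C = K"
    proof (intro equalityI subsetI)
      fix x assume "x \<in> K"
      then obtain b where "\<psi> b = x" using surj by blast
      with \<open>x \<in> K\<close> show "x \<in> (\<psi> \<circ> inv cantor_real) ` ?C"
        by (intro image_eqI[where x = "cantor_real b"]) (auto simp: inj_cantor_real)
    qed auto
  qed
qed

section \<open>Weak sequential compactness of the probability measures on a compact set\<close>

text \<open>Regularity is not part of the definition: on the Euclidean spaces considered here a
  finite Borel measure is automatically Radon.\<close>

definition prob_on :: "'a :: topological_space set \<Rightarrow> 'a measure set" where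
  "prob_on K = {\<mu>. prob_space \<mu> \<and> sets \<mu> = sets borel \<and> emeasure \<mu> (- K) = 0}"

lemma AE_prob_on:
  assumes "\<mu> \<in> prob_on K" "closed K"
  shows "AE x in \<mu>. x \<in> K"
  using assms by (intro AE_I[where N = "- K"]) (auto simp: prob_on_def)

text \<open>The section picks the least preimage in \<open>C\<close>. On the image of
  \<open>C\<close> its sublevel sets are images of the compact sets \<open>C \<inter> {..a}\<close>,
  hence compact and Borel.\<close>

lemma borel_section_of_compact:
  fixes C :: "real set" and \<phi> :: "real \<Rightarrow> 'a :: euclidean_space"
  assumes "compact C" "continuous_on C \<phi>"
  obtains s where "s \<in> borel_measurable borel"
    "\<And>x. x \<in> \<phi> ` C \<Longrightarrow> s x \<in> C" "\<And>x. x \<in> \<phi> ` C \<Longrightarrow> \<phi> (s x) = x"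
proof -
  define F where "F x = C \<inter> \<phi> -` {x}" for x
  define s where "s x = (if x \<in> \<phi> ` C then Inf (F x) else 0)" for x
  have F: "compact (F x)" for x
  proof -
    have "closed (F x)"
      unfolding F_def by (rule continuous_closed_preimage) (use assms compact_imp_closed in auto)
    then show ?thesis
      using assms(1) by (metis F_def compact_Int_closed inf.absorb_iff2 inf_le1)
  qed
  have s: "s x \<in> F x" "\<And>c. c \<in> F x \<Longrightarrow> s x \<le> c" if "x \<in> \<phi> ` C" for x
  proof -
    have "F x \<noteq> {}" using that by (auto simp: F_def)
    moreover have "bdd_below (F x)"
      by (intro bounded_imp_bdd_below compact_imp_bounded F)
    ultimately show "s x \<in> F x" "\<And>c. c \<in> F x \<Longrightarrow> s x \<le> c"
      using that closed_contains_Inf[OF _ _ compact_imp_closed[OF F]] cInf_lower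
      by (auto simp: s_def)
  qed
  show thesis
  proof
    have im: "\<phi> ` (C \<inter> {..a}) \<in> sets borel" for a
    proof -
      have "compact (\<phi> ` (C \<inter> {..a}))"
        by (rule compact_continuous_image)
           (use assms in \<open>auto intro: continuous_on_subset compact_Int_closed\<close>)
      then show ?thesis by (simp add: borel_compact)
    qed
    have im': "\<phi> ` C \<in> sets borel"
      using assms by (intro borel_compact compact_continuous_image)
    show "s \<in> borel_measurable borel"
      unfolding borel_measurable_iff_le
    proof
      fix a
      \<comment> \<open>The second set accounts for the default value 0 of \<open>s\<close> off the
        image.\<close>
      have "{x \<in> space borel. s x \<le> a} = \<phi> ` (C \<inter> {..a}) \<union> (if 0 \<le> a then - (\<phi> ` C) else {})"
      proof (intro equalityI subsetI)
        fix x assume "x \<in> {x \<in> space borel. s x \<le> a}"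
        then show "x \<in> \<phi> ` (C \<inter> {..a}) \<union> (if 0 \<le> a then - (\<phi> ` C) else {})"
        proof (cases "x \<in> \<phi> ` C")
          case True
          then have "x = \<phi> (s x)" "s x \<in> C" using s(1)[of x] by (auto simp: F_def)
          with \<open>x \<in> {x \<in> space borel. s x \<le> a}\<close> show ?thesis by blast
        next
          case False
          with \<open>x \<in> {x \<in> space borel. s x \<le> a}\<close> show ?thesis by (simp add: s_def)
        qed
      next
        fix x assume "x \<in> \<phi> ` (C \<inter> {..a}) \<union> (if 0 \<le> a then - (\<phi> ` C) else {})"
        then consider c where "c \<in> C" "c \<le> a" "x = \<phi> c" | "0 \<le> a" "x \<notin> \<phi> ` C"
          by (auto split: if_splits)
        then show "x \<in> {x \<in> space borel. s x \<le> a}"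
        proof cases
          case 1
          then have "s x \<le> c" by (intro s(2)) (auto simp: F_def)
          with 1 show ?thesis by auto
        qed (auto simp: s_def)
      qed
      also have "\<dots> \<in> sets borel" using im im' by auto
      finally show "{x \<in> space borel. s x \<le> a} \<in> sets borel" .
    qed
  qed (use s(1) in \<open>auto simp: F_def\<close>)
qed

text \<open>Tightness is what the selection theorem for weak limits asks for. Here a single bounded
  interval around \<open>C\<close> carries the full mass of every measure, whatever the
  tolerance.\<close>

lemma tight_compact_support:
  fixes C :: "real set"
  assumes "compact C" "\<And>i. real_distribution (\<mu> i)" "\<And>i. AE c in \<mu> i. c \<in> C"
  shows "tight \<mu>"
  unfolding tight_def
proof (intro conjI allI impI)
  obtain a where a: "a > 0" "\<And>x. x \<in> C \<Longrightarrow> \<bar>x\<bar> < a"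
    using compact_imp_bounded[OF assms(1)] by (auto simp: bounded_pos_less)
  fix \<epsilon> :: real assume "\<epsilon> > 0"
  have "measure (\<mu> i) {-a<..a} = 1" for i
  proof -
    interpret real_distribution "\<mu> i" by fact
    have "AE c in \<mu> i. c \<in> {-a<..a}"
      using assms(3)[of i] by eventually_elim (use a(2) in \<open>force simp: abs_less_iff\<close>)
    then show ?thesis by (subst prob_eq_1) auto
  qed
  with a(1) \<open>\<epsilon> > 0\<close> show "\<exists>a b. a < b \<and> (\<forall>n. 1 - \<epsilon> < measure (\<mu> n) {a<..b})"
    by (intro exI[of _ "-a"] exI[of _ a]) auto
qed (fact assms(2))

text \<open>The distance to \<open>C\<close>, truncated at 1 to be bounded, is a continuous test
  function with integral 0 along the sequence. Its integral against the limit is then 0 as well, and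
  it vanishes only on the closed set \<open>C\<close>.\<close>

lemma weak_limit_compact_support:
  fixes C :: "real set"
  assumes "compact C" "C \<noteq> {}" "\<And>i. real_distribution (\<mu> i)" "real_distribution M"
    "weak_conv_m \<mu> M" "\<And>i. AE c in \<mu> i. c \<in> C"
  shows "AE c in M. c \<in> C"
proof -
  interpret M: real_distribution M by fact
  define h where "h c = min 1 (infdist c C)" for c
  have h: "continuous_on UNIV h"
    unfolding h_def by (intro continuous_intros)
  have hb: "norm (h c) \<le> 1" for c
    by (auto simp: h_def infdist_nonneg)
  have "(\<lambda>n. integral\<^sup>L (\<mu> n) h) \<longlonglongrightarrow> integral\<^sup>L M h"
    using h hb assms by (intro weak_conv_imp_integral_bdd_continuous_conv[where B = 1])
      (auto simp: continuous_on_eq_continuous_at)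
  moreover have "integral\<^sup>L (\<mu> n) h = 0" for n
  proof -
    have "AE c in \<mu> n. h c = 0"
      using assms(6)[of n] by eventually_elim (simp add: h_def)
    then show ?thesis by (rule integral_eq_zero_AE)
  qed
  ultimately have "integral\<^sup>L M h = 0"
    by (simp add: LIMSEQ_const_iff)
  moreover have "integrable M h"
    using hb borel_measurable_continuous_onI[OF h]
    by (intro M.integrable_const_bound[where B = 1]) auto
  ultimately have "AE c in M. h c = 0"
    by (subst (asm) integral_nonneg_eq_0_iff_AE) (auto simp: h_def infdist_nonneg)
  then show ?thesis
  proof eventually_elim
    case (elim c)
    then show ?case
      using in_closed_iff_infdist_zero[OF compact_imp_closed[OF assms(1)] assms(2), of c]
      by (auto simp: h_def min_def split: if_splits)
  qed
qed

text \<open>The measures are pushed to the line along a Borel section, a weak limit is extracted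
  there, and it is pushed back by the continuous map. The section need not be continuous, but weak
  convergence is only applied to \<open>f \<circ> \<phi>\<close>, which composed with the section
  gives back \<open>f\<close> on \<open>K\<close>. Integrals are restricted to \<open>K\<close>
  because test functions are continuous only there.\<close>

lemma prob_on_sequentially_compact:
  fixes K :: "'a :: euclidean_space set"
  assumes K: "compact K" and \<mu>: "\<And>i. \<mu> i \<in> prob_on K"
  obtains r :: "nat \<Rightarrow> nat" and \<nu> where "strict_mono r" "\<nu> \<in> prob_on K"
    "\<And>f :: 'a \<Rightarrow> real. continuous_on K f \<Longrightarrow>
       (\<lambda>i. set_lebesgue_integral (\<mu> (r i)) K f) \<longlonglongrightarrow> set_lebesgue_integral \<nu> K f"
proof -
  obtain C :: "real set" and \<phi> where C: "compact C" and \<phi>: "continuous_on C \<phi>" "\<phi> ` C = K"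
    using compact_image_of_real_compact[OF K] .
  obtain s where s[measurable]: "s \<in> borel_measurable borel"
    and sC: "\<And>x. x \<in> K \<Longrightarrow> s x \<in> C" and \<phi>s: "\<And>x. x \<in> K \<Longrightarrow> \<phi> (s x) = x"
    using borel_section_of_compact[OF C \<phi>(1)] \<phi>(2) by metis
  have closed: "closed K" "closed C" using K C by (auto intro: compact_imp_closed)
  have [measurable]: "K \<in> sets borel" "C \<in> sets borel" using closed by auto
  have sets[measurable_cong]: "sets (\<mu> i) = sets borel" for i using \<mu> by (auto simp: prob_on_def)
  have prob: "prob_space (\<mu> i)" for i using \<mu> by (auto simp: prob_on_def)
  have AE: "AE x in \<mu> i. x \<in> K" for i using AE_prob_on[OF \<mu> closed(1)] .
  have "C \<noteq> {}"
  proof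
    assume "C = {}"
    with \<phi> AE[of 0] have "AE x in \<mu> 0. False" by auto
    with prob[of 0] show False using prob_space.AE_False by blast
  qed
  define L where "L i = distr (\<mu> i) borel s" for i
  have L: "real_distribution (L i)" for i
    unfolding L_def by (rule prob_space.real_distribution_distr[OF prob]) measurable
  have AEL: "AE c in L i. c \<in> C" for i
    unfolding L_def using AE[of i] sC by (subst AE_distr_iff) (auto elim: eventually_mono)
  obtain r M where r: "strict_mono r" and M: "real_distribution M" and w: "weak_conv_m (L \<circ> r) M"
    using tight_imp_convergent_subsubsequence[OF tight_compact_support[OF C L AEL], of id]
    unfolding comp_id by (meson strict_mono_id)
  interpret M: real_distribution M by fact
  have AEM: "AE c in M. c \<in> C"
    by (rule weak_limit_compact_support[OF C \<open>C \<noteq> {}\<close> _ M w]) (unfold comp_apply, (rule L AEL)+)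
  \<comment> \<open>The value 0 off \<open>C\<close> only serves to get a Borel map on the whole
    line; the limit \<open>M\<close> does not charge that region.\<close>
  define \<phi>' where "\<phi>' c = (if c \<in> C then \<phi> c else 0)" for c
  have [measurable]: "\<phi>' \<in> borel_measurable borel"
    unfolding \<phi>'_def by (rule borel_measurable_continuous_on_if) (use \<phi> in auto)
  show thesis
  proof
    show "strict_mono r" by fact
    show "distr M borel \<phi>' \<in> prob_on K"
      unfolding prob_on_def
    proof (intro CollectI conjI)
      show "prob_space (distr M borel \<phi>')" by (rule M.prob_space_distr) measurable
      have "AE c in M. \<phi>' c \<in> K"
        using AEM by eventually_elim (use \<phi> in \<open>auto simp: \<phi>'_def\<close>)
      then have "AE x in distr M borel \<phi>'. x \<in> K"
        by (subst AE_distr_iff) auto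
      then show "emeasure (distr M borel \<phi>') (- K) = 0"
        by (subst (asm) AE_iff_measurable[where N = "- K"]) auto
    qed simp
  next
    fix f :: "'a \<Rightarrow> real" assume f: "continuous_on K f"
    have [measurable]: "(\<lambda>x. indicator K x * f x) \<in> borel_measurable borel"
      using borel_measurable_continuous_on_indicator[OF _ f] by simp
    have f\<phi>: "continuous_on C (f \<circ> \<phi>)"
      using \<phi> f by (metis continuous_on_compose)
    then have "bounded ((f \<circ> \<phi>) ` C)"
      using C by (intro compact_imp_bounded compact_continuous_image)
    then obtain b where b: "b > 0" "\<And>c. c \<in> C \<Longrightarrow> norm ((f \<circ> \<phi>) c) \<le> b"
      unfolding bounded_pos by auto
    \<comment> \<open>Tietze extension with the same bound yields a bounded continuous test function
      on all of the line, as weak convergence demands.\<close>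
    obtain g where g: "continuous_on UNIV g" "\<And>c. c \<in> C \<Longrightarrow> g c = (f \<circ> \<phi>) c"
      "\<And>c. norm (g c) \<le> b"
      using Tietze[OF f\<phi>, of UNIV b] b closed by (auto simp: less_imp_le)
    have [measurable]: "g \<in> borel_measurable borel" by (rule borel_measurable_continuous_onI[OF g(1)])
    have "(\<lambda>n. integral\<^sup>L ((L \<circ> r) n) g) \<longlonglongrightarrow> integral\<^sup>L M g"
      using g L M w by (intro weak_conv_imp_integral_bdd_continuous_conv[where B = b])
        (auto simp: continuous_on_eq_continuous_at o_def)
    moreover have "integral\<^sup>L (L i) g = set_lebesgue_integral (\<mu> i) K f" for i
    proof -
      have "AE x in \<mu> i. g (s x) = indicator K x * f x"
        using AE[of i] by eventually_elim (use g(2) sC \<phi>s in auto)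
      then show ?thesis
        unfolding L_def set_lebesgue_integral_def real_scaleR_def
        by (subst integral_distr) (auto intro!: integral_cong_AE)
    qed
    moreover have "integral\<^sup>L M g = set_lebesgue_integral (distr M borel \<phi>') K f"
    proof -
      have "AE c in M. g c = indicator K (\<phi>' c) * f (\<phi>' c)"
        using AEM by eventually_elim (use g(2) \<phi> in \<open>auto simp: \<phi>'_def\<close>)
      then show ?thesis
        unfolding set_lebesgue_integral_def real_scaleR_def
        by (subst integral_distr) (auto intro!: integral_cong_AE)
    qed
    ultimately show "(\<lambda>i. set_lebesgue_integral (\<mu> (r i)) K f)
        \<longlonglongrightarrow> set_lebesgue_integral (distr M borel \<phi>') K f"
      by simp
  qed
qed

section \<open>Tools for the variation: mixtures with point masses and a convexity
  inequality\<close>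

text \<open>The mixture is the law of a two-stage draw: a Bernoulli trial selects the point mass at
  \<open>z\<close> or \<open>\<nu>\<close>, and the bind of measures supplies the integral
  formula.\<close>

lemma dirac_mixture:
  fixes \<nu> :: "'a :: topological_space measure"
  assumes "prob_space \<nu>" "sets \<nu> = sets borel" "0 \<le> s" "s \<le> (1 :: real)"
  obtains \<mu> :: "'a measure" where "prob_space \<mu>" "sets \<mu> = sets borel"
    "\<And>f. f \<in> borel_measurable borel \<Longrightarrow>
       (\<integral>\<^sup>+ x. (f x :: ennreal) \<partial>\<mu>) = f z * ennreal s + (\<integral>\<^sup>+ x. f x \<partial>\<nu>) * ennreal (1 - s)"
proof -
  let ?N = "\<lambda>b. if b then return borel z else \<nu>"
  let ?\<mu> = "measure_pmf (bernoulli_pmf s) \<bind> ?N"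
  have prob: "prob_space (?N b)" for b using assms by (auto intro: prob_space_return)
  have N: "?N \<in> measurable (measure_pmf (bernoulli_pmf s)) (subprob_algebra borel)"
    using assms prob by (auto simp: space_subprob_algebra prob_space_imp_subprob_space prob_space_return)
  show thesis
  proof
    show "prob_space ?\<mu>"
      by (rule measure_pmf.prob_space_bind[OF _ N]) (use prob in auto)
    show "sets ?\<mu> = sets borel"
      by (rule sets_bind) (use assms in auto)
    fix f :: "'a \<Rightarrow> ennreal" assume [measurable]: "f \<in> borel_measurable borel"
    have "(\<integral>\<^sup>+ x. f x \<partial>?\<mu>) = (\<integral>\<^sup>+ b. \<integral>\<^sup>+ x. f x \<partial>?N b \<partial>measure_pmf (bernoulli_pmf s))"
      by (rule nn_integral_bind[OF _ N]) measurable
    also have "\<dots> = f z * ennreal s + (\<integral>\<^sup>+ x. f x \<partial>\<nu>) * ennreal (1 - s)"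
      using assms by (subst nn_integral_bernoulli_pmf) (auto simp: nn_integral_return)
    finally show "(\<integral>\<^sup>+ x. f x \<partial>?\<mu>) = f z * ennreal s + (\<integral>\<^sup>+ x. f x \<partial>\<nu>) * ennreal (1 - s)" .
  qed
qed

text \<open>Young's inequality for \<open>a powr (q - 1)\<close> and \<open>b\<close>, with
  exponents \<open>q / (q - 1)\<close> and \<open>q\<close>, is the tangent line bound of the convex
  power. No derivative is taken, and \<open>a = 0\<close> is covered.\<close>

lemma powr_tangent_le:
  fixes a b q :: real
  assumes "0 \<le> a" "0 \<le> b" "1 < q"
  shows "a powr q + q * a powr (q - 1) * (b - a) \<le> b powr q"
proof -
  have "a powr (q - 1) * b \<le> (a powr (q - 1)) powr (q / (q - 1)) / (q / (q - 1)) + b powr q / q"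
    by (rule Youngs_inequality) (use assms in \<open>auto simp: field_simps\<close>)
  also have "(a powr (q - 1)) powr (q / (q - 1)) = a powr q"
    using assms by (simp add: powr_powr)
  finally have "q * (a powr (q - 1) * b) \<le> (q - 1) * a powr q + b powr q"
    using assms by (simp add: field_simps)
  moreover have "a powr (q - 1) * a = a powr q"
    using assms by (cases "a = 0") (auto simp flip: powr_add simp: powr_mult_base powr_diff)
  ultimately show ?thesis
    by (simp add: algebra_simps)
qed

section \<open>Energy minimisers for dominated kernels\<close>

text \<open>Continuity in the point of \<open>K\<close> makes potentials converge under weak
  convergence. The majorant \<open>B\<close> keeps energies finite and dominates the integrands of
  the variation.\<close>

locale dominated_kernel =
  fixes K :: "'z :: euclidean_space set" and k :: "'z \<Rightarrow> 'x \<Rightarrow> real"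
    and M :: "'x measure" and B :: "'x \<Rightarrow> real" and q :: real
  assumes compact_K: "compact K"
    and kernel_measurable: "case_prod k \<in> borel_measurable (borel \<Otimes>\<^sub>M M)"
    and kernel_continuous: "\<And>x. continuous_on K (\<lambda>z. k z x)"
    and kernel_nonneg: "\<And>z x. z \<in> K \<Longrightarrow> 0 \<le> k z x"
    and kernel_le: "\<And>z x. z \<in> K \<Longrightarrow> k z x \<le> B x"
    and exponent: "1 < q"
    and bound_integrable: "integrable M (\<lambda>x. B x powr q)"
begin

text \<open>The potential is real-valued because the variation subtracts potentials;
  \<open>ennreal_potential\<close> links it to the extended integral.\<close>

definition potential :: "'z measure \<Rightarrow> 'x \<Rightarrow> real" where
  "potential \<mu> x = set_lebesgue_integral \<mu> K (\<lambda>z. k z x)"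

definition energy :: "'z measure \<Rightarrow> ennreal" where
  "energy \<mu> = (\<integral>\<^sup>+ x. ennreal (potential \<mu> x powr q) \<partial>M)"

lemma borel_K [measurable]: "K \<in> sets borel"
  using compact_K by (rule borel_compact)

lemma section_measurable [measurable]: "(\<lambda>z. indicator K z * k z x) \<in> borel_measurable borel"
  using borel_measurable_continuous_on_indicator[OF borel_K kernel_continuous[of x]] by simp

lemma kernel_measurable_snd:
  assumes "z \<in> K"
  shows "k z \<in> borel_measurable M"
  using measurable_compose[OF measurable_Pair1'[of z borel M] kernel_measurable] by simp

lemma
  assumes "\<mu> \<in> prob_on K"
  shows ennreal_potential:
      "ennreal (potential \<mu> x) = (\<integral>\<^sup>+ z. ennreal (indicator K z * k z x) \<partial>\<mu>)"
    and potential_nonneg: "0 \<le> potential \<mu> x"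
    and potential_le: "potential \<mu> x \<le> B x"
proof -
  interpret prob_space \<mu> using assms by (simp add: prob_on_def)
  have sets[measurable_cong]: "sets \<mu> = sets borel" using assms by (simp add: prob_on_def)
  have AE: "AE z in \<mu>. z \<in> K"
    using AE_prob_on[OF assms compact_imp_closed[OF compact_K]] .
  have nonneg: "0 \<le> indicator K z * k z x" for z
    using kernel_nonneg by (auto simp: indicator_def)
  have le: "AE z in \<mu>. indicator K z * k z x \<le> B x"
    using AE by eventually_elim (auto simp: kernel_le)
  have int: "integrable \<mu> (\<lambda>z. indicator K z * k z x)"
  proof (rule integrable_const_bound)
    show "AE z in \<mu>. norm (indicator K z * k z x) \<le> B x"
      using le by eventually_elim (metis abs_of_nonneg nonneg real_norm_def)
  qed measurable
  show "ennreal (potential \<mu> x) = (\<integral>\<^sup>+ z. ennreal (indicator K z * k z x) \<partial>\<mu>)"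
    unfolding potential_def set_lebesgue_integral_def real_scaleR_def
    by (rule nn_integral_eq_integral[symmetric, OF int]) (use nonneg in auto)
  show "0 \<le> potential \<mu> x"
    unfolding potential_def set_lebesgue_integral_def real_scaleR_def by (rule Bochner_Integration.integral_nonneg) (rule nonneg)
  show "potential \<mu> x \<le> B x"
    unfolding potential_def set_lebesgue_integral_def real_scaleR_def by (rule integral_le_const[OF int le])
qed

lemma potential_measurable [measurable]:
  assumes "\<mu> \<in> prob_on K"
  shows "potential \<mu> \<in> borel_measurable M"
proof -
  interpret prob_space \<mu> using assms by (simp add: prob_on_def)
  have sets[measurable_cong]: "sets \<mu> = sets borel" using assms by (simp add: prob_on_def)
  have "(\<lambda>p. case_prod k (snd p, fst p)) \<in> borel_measurable (M \<Otimes>\<^sub>M \<mu>)"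
    by (rule measurable_compose[OF _ kernel_measurable]) measurable
  then have [measurable]: "(\<lambda>p. k (snd p) (fst p)) \<in> borel_measurable (M \<Otimes>\<^sub>M \<mu>)" by simp
  have "(\<lambda>x. \<integral>z. indicator K z * k z x \<partial>\<mu>) \<in> borel_measurable M"
    by (rule borel_measurable_lebesgue_integral) (simp add: case_prod_beta)
  then show ?thesis
    unfolding potential_def[abs_def] set_lebesgue_integral_def real_scaleR_def .
qed

lemma powr_potential_integrable:
  assumes "\<mu> \<in> prob_on K"
  shows "integrable M (\<lambda>x. potential \<mu> x powr q)"
proof (rule Bochner_Integration.integrable_bound[OF bound_integrable])
  show "AE x in M. norm (potential \<mu> x powr q) \<le> norm (B x powr q)"
    using potential_nonneg[OF assms] potential_le[OF assms] exponent
    by (auto intro!: powr_mono2)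
qed (use assms in measurable)

lemma energy_eq_integral:
  assumes "\<mu> \<in> prob_on K"
  shows "energy \<mu> = ennreal (\<integral>x. potential \<mu> x powr q \<partial>M)"
  unfolding energy_def
  by (rule nn_integral_eq_integral[OF powr_potential_integrable[OF assms]]) auto

lemma energy_minimiser_exists:
  assumes "K \<noteq> {}"
  obtains \<nu> where "\<nu> \<in> prob_on K" "\<And>\<mu>. \<mu> \<in> prob_on K \<Longrightarrow> energy \<nu> \<le> energy \<mu>"
proof -
  \<comment> \<open>A point mass shows that the infimum runs over a nonempty class, so a minimising
    sequence exists.\<close>
  obtain z where "z \<in> K" using assms by auto
  then have "return borel z \<in> prob_on K"
    by (auto simp: prob_on_def prob_space_return)
  then have "energy ` prob_on K \<noteq> {}" by auto
  then obtain e :: "nat \<Rightarrow> ennreal" where e: "decseq e" "range e \<subseteq> energy ` prob_on K"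
      "Inf (energy ` prob_on K) = (INF i. e i)"
    using ennreal_Inf_countable_INF by metis
  have "\<forall>i. \<exists>\<mu>\<in>prob_on K. energy \<mu> = e i" using e(2) by (metis image_iff rangeI subsetD)
  then obtain \<mu> where \<mu>: "\<And>i. \<mu> i \<in> prob_on K" "\<And>i. energy (\<mu> i) = e i" by metis
  obtain r \<nu> where r: "strict_mono r" and \<nu>: "\<nu> \<in> prob_on K" and
    lim: "\<And>f :: 'z \<Rightarrow> real. continuous_on K f \<Longrightarrow>
       (\<lambda>i. set_lebesgue_integral (\<mu> (r i)) K f) \<longlonglongrightarrow> set_lebesgue_integral \<nu> K f"
    by (rule prob_on_sequentially_compact[of K \<mu>, OF compact_K \<mu>(1)])
       (rule that, assumption, assumption, fast)
  have [measurable]: "potential (\<mu> i) \<in> borel_measurable M" for i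
    by (rule potential_measurable[OF \<mu>(1)])
  \<comment> \<open>Weak convergence tested on each kernel section gives pointwise convergence of
    the potentials; Fatou's lemma then gives lower semicontinuity of the energy.\<close>
  have "energy \<nu> = (\<integral>\<^sup>+ x. liminf (\<lambda>i. ennreal (potential (\<mu> (r i)) x powr q)) \<partial>M)"
    unfolding energy_def
  proof (rule nn_integral_cong)
    fix x
    have "(\<lambda>i. potential (\<mu> (r i)) x) \<longlonglongrightarrow> potential \<nu> x"
      unfolding potential_def by (rule lim[OF kernel_continuous])
    then have "(\<lambda>i. ennreal (potential (\<mu> (r i)) x powr q)) \<longlonglongrightarrow> ennreal (potential \<nu> x powr q)"
      using exponent potential_nonneg[OF \<mu>(1)]
      by (intro tendsto_ennrealI tendsto_powr') auto
    then show "ennreal (potential \<nu> x powr q) = liminf (\<lambda>i. ennreal (potential (\<mu> (r i)) x powr q))"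
      by (rule lim_imp_Liminf[OF sequentially_bot, symmetric])
  qed
  also have "\<dots> \<le> liminf (\<lambda>i. energy (\<mu> (r i)))"
    unfolding energy_def by (rule nn_integral_liminf) measurable
  also have "\<dots> = (INF i. e i)"
  proof (rule lim_imp_Liminf)
    show "(\<lambda>i. energy (\<mu> (r i))) \<longlonglongrightarrow> (INF i. e i)"
      using LIMSEQ_subseq_LIMSEQ[OF LIMSEQ_INF[OF e(1)] r] by (simp add: \<mu>(2) o_def)
  qed simp
  finally have "energy \<nu> \<le> Inf (energy ` prob_on K)" by (simp add: e(3))
  then show thesis
    using \<nu> that by (meson INF_lower order_trans)
qed

text \<open>The mixture formula lives in the extended nonnegative reals. Since the potentials are
  finite, it can be read back as an identity of reals.\<close>

lemma potential_dirac_mixture: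
  assumes \<nu>: "\<nu> \<in> prob_on K" and z: "z \<in> K" and s: "0 \<le> s" "s \<le> 1"
  obtains \<mu> where "\<mu> \<in> prob_on K" "\<And>x. potential \<mu> x = s * k z x + (1 - s) * potential \<nu> x"
proof -
  have "prob_space \<nu>" "sets \<nu> = sets borel" using \<nu> by (auto simp: prob_on_def)
  then obtain \<mu> where \<mu>: "prob_space \<mu>" "sets \<mu> = sets borel"
    "\<And>f. f \<in> borel_measurable borel \<Longrightarrow>
       (\<integral>\<^sup>+ x. (f x :: ennreal) \<partial>\<mu>) = f z * ennreal s + (\<integral>\<^sup>+ x. f x \<partial>\<nu>) * ennreal (1 - s)"
    using dirac_mixture[OF _ _ s, of \<nu> z] by metis
  have "emeasure \<mu> (- K) = 0"
    using \<mu>(3)[of "indicator (- K)"] z \<nu> \<mu>(2) by (simp add: prob_on_def)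
  then have mem: "\<mu> \<in> prob_on K" using \<mu> by (simp add: prob_on_def)
  have "potential \<mu> x = s * k z x + (1 - s) * potential \<nu> x" for x
  proof -
    have "ennreal (potential \<mu> x) = ennreal (k z x) * ennreal s
        + ennreal (potential \<nu> x) * ennreal (1 - s)"
      unfolding ennreal_potential[OF mem] ennreal_potential[OF \<nu>] using z
      by (subst \<mu>(3)) auto
    also have "\<dots> = ennreal (s * k z x + (1 - s) * potential \<nu> x)"
      using s kernel_nonneg[OF z] potential_nonneg[OF \<nu>]
      by (simp add: ennreal_plus[symmetric] ennreal_mult'[symmetric] mult.commute del: ennreal_plus)
    finally show ?thesis
      using s kernel_nonneg[OF z] potential_nonneg[OF \<nu>] potential_nonneg[OF mem]
      by (subst (asm) ennreal_inj) auto
  qed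
  with mem show thesis by (rule that)
qed

text \<open>
  Moving mass \<open>s\<close> of the minimiser to the point \<open>z\<close> does not decrease the energy.  Convexity of
  \<open>r\<^sup>q\<close>, used with the tangent at the perturbed potential, turns this into an inequality that is
  linear in the direction, so that letting \<open>s\<close> tend to \<open>0\<close> needs only dominated convergence
  and no differentiation under the integral.
\<close>

lemma energy_minimiser_variation:
  assumes \<nu>: "\<nu> \<in> prob_on K" and min: "\<And>\<mu>. \<mu> \<in> prob_on K \<Longrightarrow> energy \<nu> \<le> energy \<mu>"
    and z: "z \<in> K"
  shows "integrable M (\<lambda>x. potential \<nu> x powr (q - 1) * k z x)"
    and "(\<integral>x. potential \<nu> x powr q \<partial>M) \<le> (\<integral>x. potential \<nu> x powr (q - 1) * k z x \<partial>M)"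
proof -
  let ?g = "potential \<nu>"
  \<comment> \<open>This is the potential of the mixture that puts mass \<open>s\<close> on
    \<open>z\<close>; like the kernel it lies between 0 and \<open>B\<close>.\<close>
  define w where "w s x = s * k z x + (1 - s) * ?g x" for s x
  have [measurable]: "?g \<in> borel_measurable M" "k z \<in> borel_measurable M"
    using potential_measurable[OF \<nu>] kernel_measurable_snd[OF z] by auto
  have [measurable]: "w s \<in> borel_measurable M" for s
    unfolding w_def by measurable
  have B0: "0 \<le> B x" for x using kernel_nonneg[OF z] kernel_le[OF z] order_trans by blast
  have B_split: "B x powr (q - 1) * B x = B x powr q" for x
    using B0[of x] by (cases "B x = 0") (auto simp: powr_diff)
  have w: "0 \<le> w s x" "w s x \<le> B x" if "0 \<le> s" "s \<le> 1" for s x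
  proof -
    show "0 \<le> w s x"
      using that kernel_nonneg[OF z] potential_nonneg[OF \<nu>] by (simp add: w_def)
    have "w s x \<le> s * B x + (1 - s) * B x"
      unfolding w_def using that kernel_le[OF z] potential_le[OF \<nu>]
      by (intro add_mono mult_left_mono) auto
    then show "w s x \<le> B x" by (simp add: algebra_simps)
  qed
  \<comment> \<open>One majorant for all \<open>s\<close> at once: it yields integrability for fixed
    \<open>s\<close> and domination in the limit.\<close>
  have bound: "\<bar>w s x powr (q - 1) * d\<bar> \<le> B x powr q" if "0 \<le> s" "s \<le> 1" "\<bar>d\<bar> \<le> B x" for s x d
  proof -
    have "w s x powr (q - 1) * \<bar>d\<bar> \<le> B x powr (q - 1) * B x"
      using w[OF that(1,2)] that exponent B0 by (intro mult_mono powr_mono2) auto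
    then show ?thesis by (simp add: abs_mult B_split)
  qed
  have d: "\<bar>k z x - ?g x\<bar> \<le> B x" "\<bar>k z x\<bar> \<le> B x" "\<bar>?g x\<bar> \<le> B x" for x
    using kernel_nonneg[OF z, of x] kernel_le[OF z, of x]
      potential_nonneg[OF \<nu>, of x] potential_le[OF \<nu>, of x] by auto
  have int: "integrable M (\<lambda>x. w s x powr (q - 1) * d x)"
    if "0 \<le> s" "s \<le> 1" "\<And>x. \<bar>d x\<bar> \<le> B x" "d \<in> borel_measurable M" for s d
  proof (rule Bochner_Integration.integrable_bound[OF bound_integrable])
    show "AE x in M. norm (w s x powr (q - 1) * d x) \<le> norm (B x powr q)"
      using bound[OF that(1-3)] by auto
  qed (use that(4) in measurable)
  have w0: "w 0 = ?g" by (simp add: w_def fun_eq_iff)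
  have pos: "0 \<le> (\<integral>x. w s x powr (q - 1) * (k z x - ?g x) \<partial>M)" if s: "0 < s" "s \<le> 1" for s
  proof -
    obtain \<mu> where \<mu>: "\<mu> \<in> prob_on K" "potential \<mu> = w s"
      using potential_dirac_mixture[OF \<nu> z, of s] s unfolding w_def by (metis ext less_imp_le)
    have "ennreal (\<integral>x. ?g x powr q \<partial>M) \<le> ennreal (\<integral>x. w s x powr q \<partial>M)"
      using min[OF \<mu>(1)] \<mu> by (simp add: energy_eq_integral \<nu>)
    then have "(\<integral>x. ?g x powr q \<partial>M) \<le> (\<integral>x. w s x powr q \<partial>M)"
      by (subst (asm) ennreal_le_iff) auto
    then have "0 \<le> (\<integral>x. w s x powr q - ?g x powr q \<partial>M)"
      using powr_potential_integrable[OF \<nu>] powr_potential_integrable[OF \<mu>(1)] \<mu>(2) by simp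
    also have "\<dots> \<le> (\<integral>x. (q * s) * (w s x powr (q - 1) * (k z x - ?g x)) \<partial>M)"
    proof (rule integral_mono)
      show "integrable M (\<lambda>x. w s x powr q - ?g x powr q)"
        using powr_potential_integrable[OF \<nu>] powr_potential_integrable[OF \<mu>(1)] \<mu>(2) by simp
      show "integrable M (\<lambda>x. (q * s) * (w s x powr (q - 1) * (k z x - ?g x)))"
        using s d by (intro integrable_mult_right int) auto
      fix x
      \<comment> \<open>The tangent is taken at \<open>w s x\<close> and evaluated at the
        unperturbed potential, so that \<open>q * s\<close> factors out of the bound and can be
        cancelled.\<close>
      have "w s x powr q + q * w s x powr (q - 1) * (?g x - w s x) \<le> ?g x powr q"
        using w s potential_nonneg[OF \<nu>] exponent by (intro powr_tangent_le) auto
      moreover have "?g x - w s x = - s * (k z x - ?g x)"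
        by (simp add: w_def algebra_simps)
      ultimately show "w s x powr q - ?g x powr q \<le> q * s * (w s x powr (q - 1) * (k z x - ?g x))"
        by (simp add: algebra_simps)
    qed
    also have "\<dots> = q * s * (\<integral>x. w s x powr (q - 1) * (k z x - ?g x) \<partial>M)"
      by simp
    finally show ?thesis
      using s exponent mult_le_cancel_left_pos[of "q * s" 0] by simp
  qed
  have "(\<lambda>n. \<integral>x. w (1 / Suc n) x powr (q - 1) * (k z x - ?g x) \<partial>M)
      \<longlonglongrightarrow> (\<integral>x. w 0 x powr (q - 1) * (k z x - ?g x) \<partial>M)"
  proof (rule integral_dominated_convergence[OF _ _ bound_integrable])
    show "AE x in M. (\<lambda>n. w (1 / Suc n) x powr (q - 1) * (k z x - ?g x))
        \<longlonglongrightarrow> w 0 x powr (q - 1) * (k z x - ?g x)"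
    proof (rule AE_I2)
      fix x
      have "(\<lambda>n. 1 / real (Suc n)) \<longlonglongrightarrow> 0"
        using LIMSEQ_inverse_real_of_nat by (simp add: inverse_eq_divide)
      then have "(\<lambda>n. w (1 / Suc n) x) \<longlonglongrightarrow> w 0 x"
        unfolding w_def by (intro tendsto_add tendsto_mult tendsto_diff tendsto_const)
      then show "(\<lambda>n. w (1 / Suc n) x powr (q - 1) * (k z x - ?g x))
          \<longlonglongrightarrow> w 0 x powr (q - 1) * (k z x - ?g x)"
        using exponent w by (intro tendsto_mult tendsto_powr' tendsto_const) auto
    qed
    show "AE x in M. norm (w (1 / Suc n) x powr (q - 1) * (k z x - ?g x)) \<le> B x powr q" for n
      using bound[of "1 / Suc n"] d(1) by auto
  qed measurable
  then have "0 \<le> (\<integral>x. w 0 x powr (q - 1) * (k z x - ?g x) \<partial>M)"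
    by (rule LIMSEQ_le_const) (auto intro!: exI pos)
  moreover have int_k: "integrable M (\<lambda>x. ?g x powr (q - 1) * k z x)"
    and int_g: "integrable M (\<lambda>x. ?g x powr (q - 1) * ?g x)"
    using int[of 0 "k z"] int[of 0 ?g] d by (auto simp: w0)
  moreover have "?g x powr (q - 1) * ?g x = ?g x powr q" for x
    using potential_nonneg[OF \<nu>, of x] by (cases "?g x = 0") (auto simp: powr_diff)
  ultimately show "(\<integral>x. ?g x powr q \<partial>M) \<le> (\<integral>x. ?g x powr (q - 1) * k z x \<partial>M)"
    by (simp add: w0 right_diff_distrib)
  show "integrable M (\<lambda>x. ?g x powr (q - 1) * k z x)" by (rule int_k)
qed

end

section \<open>Hoelder's inequality and the Poisson kernel\<close>

lemma epowr_measurable [measurable]: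
  assumes [measurable]: "f \<in> borel_measurable M"
  shows "(\<lambda>x. epowr (f x) r) \<in> borel_measurable M"
  unfolding epowr_def by measurable

lemma epowr_ennreal [simp]: "0 \<le> a \<Longrightarrow> epowr (ennreal a) r = ennreal (a powr r)"
  by (simp add: epowr_def)

lemma epowr_top [simp]: "epowr top r = top"
  by (simp add: epowr_def)

lemma epowr_0 [simp]: "epowr 0 r = 0"
  by (simp add: epowr_def)

lemma epowr_1 [simp]: "epowr 1 r = 1"
  using epowr_ennreal[of 1 r] by simp

lemma epowr_mono:
  assumes "x \<le> y" "0 \<le> r"
  shows "epowr x r \<le> epowr y r"
proof (cases y)
  case (real b)
  moreover from this assms obtain a where "x = ennreal a" "0 \<le> a" by (cases x) (auto simp: top_unique)
  ultimately show ?thesis using assms by (auto intro!: powr_mono2)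
qed simp

lemma epowr_epowr: "epowr (epowr x a) b = epowr x (a * b)"
  by (cases x) (simp_all add: powr_powr)

lemma epowr_exponent_1 [simp]: "epowr x 1 = x"
  by (cases x) simp_all

lemma epowr_Lp_norm: "0 < p \<Longrightarrow> epowr (Lp_norm p g) p = (\<integral>\<^sup>+ x. epowr (g x) p \<partial>lebesgue)"
  by (simp add: Lp_norm_def epowr_epowr)

lemma Lp_norm_le_1_iff:
  assumes "0 < p"
  shows "Lp_norm p g \<le> 1 \<longleftrightarrow> (\<integral>\<^sup>+ x. epowr (g x) p \<partial>lebesgue) \<le> 1"
proof
  assume "Lp_norm p g \<le> 1"
  from epowr_mono[OF this, of p] assms show "(\<integral>\<^sup>+ x. epowr (g x) p \<partial>lebesgue) \<le> 1"
    by (simp add: epowr_Lp_norm)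
next
  assume "(\<integral>\<^sup>+ x. epowr (g x) p \<partial>lebesgue) \<le> 1"
  from epowr_mono[OF this, of "1 / p"] assms show "Lp_norm p g \<le> 1"
    by (simp add: Lp_norm_def)
qed

text \<open>
  The weights are those that make the integrated Young inequality sharp when \<open>\<integral> v\<^sup>p = c\<close> and
  \<open>\<integral> u\<^sup>q = 1\<close>.
\<close>

lemma epowr_Young:
  fixes p q c :: real
  assumes pq: "1 < p" "1 < q" "1 / p + 1 / q = 1" and c: "0 < c"
  shows "u * v \<le> ennreal (c powr (- 1 / q) / p) * epowr v p + ennreal (c powr (1 / p) / q) * epowr u q"
\<comment> \<open>Both weights are positive, so an infinite factor already makes the right-hand side
  infinite.\<close>
proof (cases "u = top \<or> v = top")
  case True
  have "ennreal (c powr (- 1 / q) / p) \<noteq> 0" "ennreal (c powr (1 / p) / q) \<noteq> 0"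
    using pq c by auto
  then have "ennreal (c powr (- 1 / q) / p) * top = top" "ennreal (c powr (1 / p) / q) * top = top"
    by (simp_all add: ennreal_mult_top)
  with True have "ennreal (c powr (- 1 / q) / p) * epowr v p + ennreal (c powr (1 / p) / q) * epowr u q = top"
    by (elim disjE) (simp_all only: epowr_top, simp_all)
  then show ?thesis by (metis top_greatest)
next
  case False
  then have "u < top" "v < top" by (simp_all add: less_top)
  then obtain a b where ab: "u = ennreal a" "0 \<le> a" "v = ennreal b" "0 \<le> b"
    by (metis ennreal_enn2real enn2real_nonneg)
  \<comment> \<open>Scaling one factor by \<open>d\<close> and the other by its inverse keeps the
    product. This \<open>d\<close> satisfies \<open>d powr q = c powr (1 / p)\<close> and
    \<open>d powr - p = c powr (- 1 / q)\<close>, the desired weights.\<close>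
  define d where "d = c powr (1 / (p * q))"
  have d: "0 < d" using c by (simp add: d_def)
  have "a * b = (a * d) * (b / d)" using d by simp
  also have "\<dots> \<le> (a * d) powr q / q + (b / d) powr p / p"
    using ab d pq by (intro Youngs_inequality) auto
  also have "(a * d) powr q = a powr q * c powr (1 / p)"
    using ab c pq by (simp add: d_def powr_mult powr_powr)
  also have "(b / d) powr p = b powr p * c powr (- 1 / q)"
    using ab c pq d by (simp add: d_def powr_divide powr_powr powr_minus_divide)
  finally have *: "a * b \<le> c powr (- 1 / q) / p * b powr p + c powr (1 / p) / q * a powr q"
    by (simp add: algebra_simps)
  define k l where "k = c powr (- 1 / q) / p" and "l = c powr (1 / p) / q"
  have kl: "0 \<le> k" "0 \<le> l" using pq by (auto simp: k_def l_def)
  have "ennreal (a * b) \<le> ennreal (k * b powr p + l * a powr q)"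
    using * by (intro ennreal_leI) (simp only: k_def l_def)
  then show ?thesis
    using ab kl unfolding k_def[symmetric] l_def[symmetric] by (simp add: ennreal_mult)
qed

text \<open>\<open>epowr_Young\<close> is integrated with \<open>c\<close> the integral of the
  \<open>p\<close>-th power of \<open>v\<close>; the two terms add up to
  \<open>c powr (1 / p)\<close> by conjugacy. The case \<open>c = 0\<close> forces the product to
  vanish almost everywhere, and an infinite integral is trivial.\<close>

lemma epowr_Hoelder:
  fixes p q :: real
  assumes pq: "1 < p" "1 < q" "1 / p + 1 / q = 1"
    and [measurable]: "u \<in> borel_measurable M" "v \<in> borel_measurable M"
    and u: "(\<integral>\<^sup>+ x. epowr (u x) q \<partial>M) \<le> 1"
  shows "epowr (\<integral>\<^sup>+ x. u x * v x \<partial>M) p \<le> (\<integral>\<^sup>+ x. epowr (v x) p \<partial>M)"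
proof (cases "\<integral>\<^sup>+ x. epowr (v x) p \<partial>M")
  case (real c)
  show ?thesis
  proof (cases "c = 0")
    case True
    with real have "(\<integral>\<^sup>+ x. epowr (v x) p \<partial>M) = 0" by simp
    then have "AE x in M. epowr (v x) p = 0"
      by (subst (asm) nn_integral_0_iff_AE) auto
    then have "AE x in M. u x * v x = 0"
    proof eventually_elim
      case (elim x)
      have "epowr (epowr (v x) p) (1 / p) = v x" using pq by (simp add: epowr_epowr)
      with elim show ?case by simp
    qed
    then have "(\<integral>\<^sup>+ x. u x * v x \<partial>M) = 0"
      by (subst nn_integral_0_iff_AE) auto
    then show ?thesis by simp
  next
    case False
    with real have c: "0 < c" by simp
    have "(\<integral>\<^sup>+ x. u x * v x \<partial>M) \<le>
      (\<integral>\<^sup>+ x. ennreal (c powr (- 1 / q) / p) * epowr (v x) p + ennreal (c powr (1 / p) / q) * epowr (u x) q \<partial>M)"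
      by (intro nn_integral_mono epowr_Young pq c)
    also have "\<dots> = ennreal (c powr (- 1 / q) / p) * ennreal c
        + ennreal (c powr (1 / p) / q) * (\<integral>\<^sup>+ x. epowr (u x) q \<partial>M)"
      by (simp add: nn_integral_add nn_integral_cmult real(2))
    also have "\<dots> \<le> ennreal (c powr (- 1 / q) / p) * ennreal c + ennreal (c powr (1 / p) / q) * 1"
      by (intro add_left_mono mult_left_mono u) auto
    also have "\<dots> = ennreal (c powr (- 1 / q) / p * c + c powr (1 / p) / q)"
    proof -
      define k l where "k = c powr (- 1 / q) / p" and "l = c powr (1 / p) / q"
      have "0 \<le> k" "0 \<le> l" using pq by (auto simp: k_def l_def)
      then show ?thesis
        using c unfolding k_def[symmetric] l_def[symmetric] by (simp add: ennreal_mult)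
    qed
    also have "c powr (- 1 / q) / p * c + c powr (1 / p) / q = c powr (1 / p)"
    proof -
      have "c powr (- 1 / q) * c = c powr (- 1 / q + 1)" unfolding powr_add using c by simp
      also have "- 1 / q + 1 = 1 / p" using pq(3) by simp
      finally have "c powr (- 1 / q) / p * c + c powr (1 / p) / q = c powr (1 / p) * (1 / p + 1 / q)"
        by (simp add: field_simps)
      then show ?thesis using pq(3) by simp
    qed
    finally have "epowr (\<integral>\<^sup>+ x. u x * v x \<partial>M) p \<le> epowr (ennreal (c powr (1 / p))) p"
      using pq by (intro epowr_mono) auto
    also have "\<dots> = ennreal c" using c pq by (simp add: powr_powr)
    finally show ?thesis by (simp add: real(2))
  qed
qed simp

section \<open>Finite Radon measures\<close>

text \<open>Inner regularity by compact sets is automatic for finite Borel measures on a Polish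
  space.\<close>

lemma finite_borel_radon:
  fixes \<mu> :: "'a :: {second_countable_topology, complete_space} measure"
  assumes "sets \<mu> = sets borel" "emeasure \<mu> UNIV < \<infinity>"
  shows "radon_measure \<mu>"
proof -
  have space: "space \<mu> = UNIV" using sets_eq_imp_space_eq[OF assms(1)] by simp
  have "emeasure \<mu> C < \<infinity>" for C
    using emeasure_space[of \<mu> C] assms(2) by (simp add: space le_less_trans)
  moreover have "emeasure \<mu> (space \<mu>) \<noteq> \<infinity>" using assms(2) space by auto
  ultimately show ?thesis
    unfolding radon_measure_def using assms(1) inner_regular[OF assms(1)] by blast
qed

text \<open>Finiteness on compact sets is enough, since \<open>K\<close> is compact and its
  complement is null.\<close>

lemma radon_on_finite_measure:
  fixes K :: "'a :: t2_space set"
  assumes "\<mu> \<in> radon_on K" "compact K"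
  shows "sets \<mu> = sets borel" "finite_measure \<mu>"
proof -
  show sets: "sets \<mu> = sets borel" using assms(1) by (simp add: radon_on_def radon_measure_def)
  have space: "space \<mu> = UNIV" using sets_eq_imp_space_eq[OF sets] by simp
  have K: "K \<in> sets borel" using assms(2) by (rule borel_compact)
  have "emeasure \<mu> (K \<union> - K) \<le> emeasure \<mu> K + emeasure \<mu> (- K)"
    using K by (intro emeasure_subadditive) (auto simp: sets)
  also have "\<dots> < \<infinity>"
    using assms(1,2) by (auto simp: radon_on_def radon_measure_def)
  finally show "finite_measure \<mu>"
    by (intro finite_measureI) (simp add: space)
qed

text \<open>The integrand is dominated by a sum over dyadic balls, whose volumes grow like
  \<open>2 ^ (j * DIM('a))\<close>. What results is a geometric series of ratio
  \<open>2 powr (DIM('a) - s)\<close>, less than 1.\<close>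

lemma nn_integral_norm_powr_finite:
  fixes s :: real
  assumes "real DIM('a) < s"
  shows "(\<integral>\<^sup>+ x. ennreal ((1 + norm (x :: 'a :: euclidean_space)) powr - s) \<partial>lborel) < \<infinity>"
proof -
  let ?d = "DIM('a)"
  let ?V = "unit_ball_vol (real ?d)"
  define \<rho> where "\<rho> = 2 powr (?d - s)"
  have \<rho>: "0 \<le> \<rho>" "\<rho> < 1" using assms by (auto simp: \<rho>_def powr_less_one)
  have le_suminf: "f j \<le> (\<Sum>j. f j)" for f :: "nat \<Rightarrow> ennreal" and j
    using sum_le_suminf[OF summableI, of "{j}" f] by simp
  have le: "ennreal ((1 + norm x) powr - s) \<le>
      (\<Sum>j. ennreal (2 powr s * (2 ^ j) powr - s) * indicator (ball 0 (2 ^ j)) x)" for x :: 'a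
  proof -
    obtain m where m: "1 + norm x < 2 ^ m" using real_arch_pow[of 2 "1 + norm x"] by auto
    \<comment> \<open>Minimality of \<open>j\<close> makes \<open>1 + norm x\<close> at least half
      of \<open>2 ^ j\<close>; the factor \<open>2 powr s\<close> in the series pays for that
      half.\<close>
    define j where "j = (LEAST m. 1 + norm x < 2 ^ m)"
    have j: "1 + norm x < 2 ^ j" unfolding j_def using m by (rule LeastI)
    have "j \<noteq> 0"
    proof
      assume "j = 0"
      with j show False by simp
    qed
    then obtain i where i: "j = Suc i" by (cases j) auto
    have "2 ^ i \<le> 1 + norm x"
      using not_less_Least[of i "\<lambda>m. 1 + norm x < 2 ^ m"] i by (simp add: j_def)
    then have "(1 + norm x) powr - s \<le> (2 ^ i) powr - s"
      using assms by (intro powr_mono2') auto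
    also have "(2 ^ i) powr - s = 2 powr s * (2 ^ j) powr - s"
      by (simp add: i powr_mult powr_minus field_simps)
    finally have "ennreal ((1 + norm x) powr - s) \<le>
        ennreal (2 powr s * (2 ^ j) powr - s) * indicator (ball 0 (2 ^ j)) x"
      using j by (auto simp: indicator_def intro!: ennreal_leI)
    also have "\<dots> \<le> (\<Sum>j. ennreal (2 powr s * (2 ^ j) powr - s) * indicator (ball 0 (2 ^ j)) x)"
      by (rule le_suminf)
    finally show ?thesis .
  qed
  have "(\<integral>\<^sup>+ x. ennreal ((1 + norm (x :: 'a)) powr - s) \<partial>lborel) \<le>
     (\<integral>\<^sup>+ x. (\<Sum>j. ennreal (2 powr s * (2 ^ j) powr - s) * indicator (ball 0 (2 ^ j)) (x :: 'a)) \<partial>lborel)"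
    by (intro nn_integral_mono le)
  also have "\<dots> = (\<Sum>j. ennreal (2 powr s * (2 ^ j) powr - s) * emeasure lborel (ball (0 :: 'a) (2 ^ j)))"
  proof (subst nn_integral_suminf)
    have [measurable]: "ball (0 :: 'a) (2 ^ j) \<in> sets borel" for j by simp
    show "(\<lambda>x. ennreal (2 powr s * (2 ^ j) powr - s) * indicator (ball (0 :: 'a) (2 ^ j)) x)
        \<in> borel_measurable lborel" for j
      by measurable
  qed (intro suminf_cong nn_integral_cmult_indicator, simp)
  also have "\<dots> = (\<Sum>j. ennreal (2 powr s * ?V * \<rho> ^ j))"
  proof (rule suminf_cong)
    fix j
    have "(2 ^ j) powr - s * (2 ^ j) ^ ?d = \<rho> ^ j"
    proof -
      have 1: "(2 ^ j :: real) powr - s = 2 powr (- s * j)"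
        using powr_powr[of 2 "real j" "- s"] by (simp add: powr_realpow mult.commute)
      have 2: "(2 ^ j :: real) ^ ?d = 2 powr (real ?d * j)"
        using powr_realpow[of 2 "j * ?d"] by (simp add: power_mult[symmetric] mult.commute)
      have 3: "\<rho> ^ j = 2 powr ((?d - s) * j)"
        using powr_realpow[of \<rho> j] by (simp add: \<rho>_def powr_powr)
      show ?thesis
        unfolding 1 2 3 powr_add[symmetric] by (simp add: left_diff_distrib)
    qed
    then have "2 powr s * (2 ^ j) powr - s * (?V * (2 ^ j) ^ ?d) = 2 powr s * ?V * \<rho> ^ j"
      by (simp only: mult_ac)
    moreover have "ennreal (2 powr s * (2 ^ j) powr - s) * emeasure lborel (ball (0 :: 'a) (2 ^ j)) =
        ennreal (2 powr s * (2 ^ j) powr - s * (?V * (2 ^ j) ^ ?d))"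
      by (subst emeasure_ball, simp) (rule ennreal_mult''[symmetric], simp)
    ultimately show "ennreal (2 powr s * (2 ^ j) powr - s) * emeasure lborel (ball (0 :: 'a) (2 ^ j)) =
        ennreal (2 powr s * ?V * \<rho> ^ j)" by (simp only:)
  qed
  also have "\<dots> = ennreal (\<Sum>j. 2 powr s * ?V * \<rho> ^ j)"
    using \<rho> by (intro suminf_ennreal2 summable_mult summable_geometric) (auto simp: unit_ball_vol_nonneg)
  finally show ?thesis by (simp add: le_less_trans)
qed

section \<open>Positivity, measurability and decay of the Poisson kernel\<close>

lemma poisson_const_pos: "0 < n \<Longrightarrow> 0 < \<alpha> \<Longrightarrow> 0 < poisson_const n \<alpha>"
  unfolding poisson_const_def by (intro divide_pos_pos mult_pos_pos Gamma_real_pos) auto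

lemma poisson_kernel_pos:
  assumes "0 < \<alpha>" "0 < t"
  shows "0 < poisson_kernel \<alpha> t (x :: real ^ 'n)"
proof -
  have "0 < (norm x)\<^sup>2 + t\<^sup>2" using assms by (simp add: add_nonneg_pos)
  then show ?thesis
    unfolding poisson_kernel_def
    using assms poisson_const_pos[of "CARD('n)" \<alpha>] by simp
qed

text \<open>Both orders of the variables are needed: the first for Fubini and for sections, the
  second for measurability of the adjoint.\<close>

lemma poisson_kernel_measurable:
  fixes M1 :: "((real ^ 'n) \<times> real) measure"
  assumes "sets M1 = sets borel" "sets M2 = sets borel"
  shows "(\<lambda>(zt, x). poisson_kernel \<alpha> (snd zt) (x - fst zt)) \<in> borel_measurable (M1 \<Otimes>\<^sub>M M2)"
    and "(\<lambda>(x, zt). poisson_kernel \<alpha> (snd zt) (x - fst zt)) \<in> borel_measurable (M2 \<Otimes>\<^sub>M M1)"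
proof -
  have gen: "(\<lambda>p. c * t p powr \<alpha> * ((d p)\<^sup>2 + (t p)\<^sup>2) powr e) \<in> borel_measurable borel"
    if [measurable]: "t \<in> borel_measurable borel" "d \<in> borel_measurable borel"
    for t d :: "'p :: topological_space \<Rightarrow> real" and c e
    by measurable
  have sets: "sets (M1 \<Otimes>\<^sub>M M2) = sets borel" "sets (M2 \<Otimes>\<^sub>M M1) = sets borel"
    using sets_pair_measure_cong[OF assms] sets_pair_measure_cong[OF assms(2,1)]
    unfolding borel_prod .
  show "(\<lambda>(zt, x). poisson_kernel \<alpha> (snd zt) (x - fst zt)) \<in> borel_measurable (M1 \<Otimes>\<^sub>M M2)"
    "(\<lambda>(x, zt). poisson_kernel \<alpha> (snd zt) (x - fst zt)) \<in> borel_measurable (M2 \<Otimes>\<^sub>M M1)"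
    unfolding measurable_cong_sets[OF sets(1) refl] measurable_cong_sets[OF sets(2) refl]
      poisson_kernel_def case_prod_beta
    by (intro gen borel_measurable_continuous_onI continuous_intros)+
qed

lemma poisson_kernel_continuous:
  assumes "K \<subseteq> half_space"
  shows "continuous_on K (\<lambda>zt. poisson_kernel \<alpha> (snd zt) ((x :: real ^ 'n) - fst zt))"
proof -
  have pos: "0 < snd zt" if "zt \<in> K" for zt using assms that by (auto simp: half_space_def)
  have "(norm (x - fst zt))\<^sup>2 + (snd zt)\<^sup>2 \<noteq> 0" if "zt \<in> K" for zt
    using pos[OF that] by (metis add_nonneg_pos less_irrefl zero_le_power2 zero_less_power2)
  then show ?thesis
    unfolding poisson_kernel_def using pos by (intro continuous_intros) (auto dest: pos)
qed

text \<open>On \<open>K\<close> the height is bounded away from 0 and everything is bounded, so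
  \<open>1 + norm x\<close> is at most a constant times the distance to the base point plus the
  height. The negative exponent turns this into decay.\<close>

lemma poisson_kernel_le:
  fixes K :: "((real ^ 'n) \<times> real) set"
  assumes "0 < \<alpha>" "compact K" "K \<subseteq> half_space"
  obtains D where "0 \<le> D" "\<And>zt x. zt \<in> K \<Longrightarrow>
    poisson_kernel \<alpha> (snd zt) (x - fst zt) \<le> D * (1 + norm x) powr - (real CARD('n) + \<alpha>)"
proof (cases "K = {}")
  case False
  let ?e = "real CARD('n) + \<alpha>"
  obtain zt0 where zt0: "zt0 \<in> K" "\<And>zt. zt \<in> K \<Longrightarrow> snd zt0 \<le> snd zt"
    using continuous_attains_inf[OF assms(2) False continuous_on_snd[OF continuous_on_id]] by blast
  define t0 where "t0 = snd zt0"
  have t0: "0 < t0" "\<And>zt. zt \<in> K \<Longrightarrow> t0 \<le> snd zt"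
    using zt0 assms(3) by (auto simp: t0_def half_space_def)
  obtain R where R: "0 < R" "\<And>zt. zt \<in> K \<Longrightarrow> norm zt \<le> R"
    using compact_imp_bounded[OF assms(2)] by (auto simp: bounded_pos)
  \<comment> \<open>As \<open>t \<ge> t0\<close>, the constant \<open>1 + R\<close> is absorbed into
    \<open>(1 + R) / t0 * t\<close>. The 2 in \<open>b\<close> below comes from
    \<open>(y + t)\<^sup>2 \<le> 2 * (y\<^sup>2 + t\<^sup>2)\<close>.\<close>
  define m where "m = 1 + (1 + R) / t0"
  have m: "1 \<le> m" using t0 R by (simp add: m_def)
  define b where "b = 1 / (2 * m\<^sup>2)"
  have b: "0 < b" using m by (simp add: b_def)
  define D where "D = poisson_const CARD('n) \<alpha> * R powr \<alpha> * b powr (- ?e / 2)"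
  have c: "0 < poisson_const CARD('n) \<alpha>" using assms by (intro poisson_const_pos) auto
  show thesis
  proof
    show "0 \<le> D" using c by (simp add: D_def)
    fix zt :: "(real ^ 'n) \<times> real" and x :: "real ^ 'n" assume "zt \<in> K"
    then obtain z t where zt: "zt = (z, t)" "t0 \<le> t" "norm z \<le> R" "t \<le> R"
      using t0(2)[of zt] R(2)[of zt] norm_fst_le[of "fst zt" "snd zt"] norm_snd_le[of "snd zt" "fst zt"]
      by (cases zt) auto
    define y where "y = norm (x - z)"
    have "1 + norm x \<le> 1 + R + y"
      using norm_triangle_sub[of x z] zt by (simp add: y_def)
    also have "1 + R = (1 + R) / t0 * t0"
      using t0(1) by simp
    also have "(1 + R) / t0 * t0 + y \<le> (1 + R) / t0 * t + y"
      using t0(1) zt(2) R(1) by (intro add_right_mono mult_left_mono) auto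
    also have "(1 + R) / t0 * t + y \<le> m * (y + t)"
    proof -
      have "r * t + y \<le> (1 + r) * (y + t)" if "0 \<le> r * y" "0 \<le> t" for r
        using that by (simp add: algebra_simps)
      moreover have "0 \<le> (1 + R) / t0 * y" "0 \<le> t" using t0 R zt by (auto simp: y_def)
      ultimately show ?thesis unfolding m_def by blast
    qed
    finally have "(1 + norm x)\<^sup>2 \<le> (m * (y + t))\<^sup>2"
      by (intro power_mono) auto
    also have "\<dots> \<le> m\<^sup>2 * (2 * (y\<^sup>2 + t\<^sup>2))"
    proof -
      have "(y + t)\<^sup>2 \<le> 2 * (y\<^sup>2 + t\<^sup>2)"
        using zero_le_power2[of "y - t"] by (simp add: power2_eq_square algebra_simps)
      then show ?thesis by (simp add: power_mult_distrib mult_left_mono)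
    qed
    finally have "b * (1 + norm x)\<^sup>2 \<le> y\<^sup>2 + t\<^sup>2"
      using m by (simp add: b_def field_simps)
    moreover have "0 < 1 + norm x" by (simp add: add_pos_nonneg)
    ultimately have "(y\<^sup>2 + t\<^sup>2) powr (- ?e / 2) \<le> (b * (1 + norm x)\<^sup>2) powr (- ?e / 2)"
      using assms(1) b by (intro powr_mono2') auto
    also have "\<dots> = b powr (- ?e / 2) * (1 + norm x) powr - ?e"
    proof -
      have "(1 + norm x)\<^sup>2 = (1 + norm x) powr 2" using \<open>0 < 1 + norm x\<close> by simp
      moreover have "2 * (- ?e / 2) = - ?e" by (simp add: field_simps)
      ultimately have "((1 + norm x)\<^sup>2) powr (- ?e / 2) = (1 + norm x) powr - ?e"
        by (simp only: powr_powr)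
      then show ?thesis using b by (simp add: powr_mult)
    qed
    finally have 1: "(y\<^sup>2 + t\<^sup>2) powr (- ?e / 2) \<le> b powr (- ?e / 2) * (1 + norm x) powr - ?e" .
    have "t powr \<alpha> \<le> R powr \<alpha>" using zt t0 assms(1) by (intro powr_mono2) auto
    with 1 c have "poisson_const CARD('n) \<alpha> * t powr \<alpha> * (y\<^sup>2 + t\<^sup>2) powr (- ?e / 2)
        \<le> poisson_const CARD('n) \<alpha> * R powr \<alpha> * (b powr (- ?e / 2) * (1 + norm x) powr - ?e)"
      by (intro mult_mono) auto
    then show "poisson_kernel \<alpha> (snd zt) (x - fst zt) \<le> D * (1 + norm x) powr - ?e"
      by (simp add: poisson_kernel_def zt D_def y_def mult_ac)
  qed
qed (use that[of 0] in auto)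

section \<open>The adjoint operator and Fubini's theorem\<close>

lemma half_space_borel [measurable]: "half_space \<in> sets borel"
  unfolding half_space_def by (intro borel_open open_Times) auto

lemma poisson_adj_measurable:
  fixes \<mu> :: "((real ^ 'n) \<times> real) measure"
  assumes sets[measurable_cong]: "sets \<mu> = sets borel" and "finite_measure \<mu>"
  shows "poisson_adj \<alpha> \<mu> \<in> borel_measurable lborel"
proof -
  interpret finite_measure \<mu> by fact
  have [measurable]: "(\<lambda>p. poisson_kernel \<alpha> (snd (snd p)) (fst p - fst (snd p)))
      \<in> borel_measurable (lborel \<Otimes>\<^sub>M \<mu>)"
    using poisson_kernel_measurable(2)[OF sets, of lborel \<alpha>] by (simp add: case_prod_beta)
  have [measurable]: "(\<lambda>p. indicator half_space (snd p) :: ennreal) \<in> borel_measurable (lborel \<Otimes>\<^sub>M \<mu>)"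
    by (rule measurable_compose[OF measurable_snd]) (simp add: sets half_space_borel)
  show ?thesis
    unfolding poisson_adj_def[abs_def]
    by (rule borel_measurable_nn_integral) (simp add: case_prod_beta)
qed

lemma poisson_Fubini:
  fixes \<mu> :: "((real ^ 'n) \<times> real) measure"
  assumes sets[measurable_cong]: "sets \<mu> = sets borel" and "finite_measure \<mu>"
    and f: "f \<in> borel_measurable lebesgue"
  shows "(\<integral>\<^sup>+ zt\<in>half_space. poisson_ext \<alpha> f zt \<partial>\<mu>) = (\<integral>\<^sup>+ x. poisson_adj \<alpha> \<mu> x * f x \<partial>lebesgue)"
proof -
  interpret finite_measure \<mu> by fact
  interpret pair_sigma_finite \<mu> "lborel :: (real ^ 'n) measure" ..
  \<comment> \<open>A Lebesgue measurable \<open>f\<close> need not be Borel; an almost everywhere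
    equal Borel function gives joint measurability on the product and leaves all integrals
    unchanged.\<close>
  obtain h where h[measurable]: "h \<in> borel_measurable lborel" and fh: "AE x in lborel. f x = h x"
    using completion_ex_borel_measurable[OF f] by auto
  let ?k = "\<lambda>zt y. ennreal (poisson_kernel \<alpha> (snd zt) (y - fst zt))"
  have sym: "poisson_kernel \<alpha> t (a - b) = poisson_kernel \<alpha> t (b - a)" for t and a b :: "real ^ 'n"
    by (simp add: poisson_kernel_def norm_minus_commute)
  have k[measurable]: "(\<lambda>p. ?k (fst p) (snd p)) \<in> borel_measurable (\<mu> \<Otimes>\<^sub>M lborel)"
    using poisson_kernel_measurable(1)[OF sets, of lborel \<alpha>] by (simp add: case_prod_beta)
  have [measurable]: "?k zt \<in> borel_measurable lborel" for zt :: "(real ^ 'n) \<times> real"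
    using measurable_compose[OF measurable_Pair1'[of zt \<mu> lborel] k] sets_eq_imp_space_eq[OF sets]
    by simp
  have [measurable]: "(\<lambda>zt. ?k zt y) \<in> borel_measurable \<mu>" for y
    using measurable_compose[OF measurable_Pair2'[of y lborel \<mu>] k] by simp
  have [measurable]: "(\<lambda>p. indicator half_space (fst p) :: ennreal) \<in> borel_measurable (\<mu> \<Otimes>\<^sub>M lborel)"
    by (rule measurable_compose[OF measurable_fst]) (simp add: sets half_space_borel)
  have "poisson_ext \<alpha> f zt = (\<integral>\<^sup>+ y. ?k zt y * h y \<partial>lborel)" for zt
    unfolding poisson_ext_def case_prod_beta nn_integral_completion
    by (rule nn_integral_cong_AE) (use fh in eventually_elim, simp add: sym)
  then have "(\<integral>\<^sup>+ zt\<in>half_space. poisson_ext \<alpha> f zt \<partial>\<mu>) =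
      (\<integral>\<^sup>+ zt. (\<integral>\<^sup>+ y. ?k zt y * h y \<partial>lborel) * indicator half_space zt \<partial>\<mu>)" by simp
  also have "\<dots> = (\<integral>\<^sup>+ zt. (\<integral>\<^sup>+ y. ?k zt y * h y * indicator half_space zt \<partial>lborel) \<partial>\<mu>)"
    by (intro nn_integral_cong nn_integral_multc[symmetric]) measurable
  also have "\<dots> = (\<integral>\<^sup>+ y. (\<integral>\<^sup>+ zt. ?k zt y * h y * indicator half_space zt \<partial>\<mu>) \<partial>lborel)"
    by (rule Fubini'[symmetric]) (simp add: case_prod_beta)
  also have "\<dots> = (\<integral>\<^sup>+ y. poisson_adj \<alpha> \<mu> y * h y \<partial>lborel)"
  proof (rule nn_integral_cong)
    fix y
    have "(\<integral>\<^sup>+ zt. ?k zt y * h y * indicator half_space zt \<partial>\<mu>) =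
        (\<integral>\<^sup>+ zt. (?k zt y * indicator half_space zt) * h y \<partial>\<mu>)"
      by (simp add: mult_ac)
    also have "\<dots> = poisson_adj \<alpha> \<mu> y * h y"
      unfolding poisson_adj_def
      by (rule nn_integral_multc) measurable
    finally show "(\<integral>\<^sup>+ zt. ?k zt y * h y * indicator half_space zt \<partial>\<mu>) = poisson_adj \<alpha> \<mu> y * h y" .
  qed
  also have "\<dots> = (\<integral>\<^sup>+ x. poisson_adj \<alpha> \<mu> x * f x \<partial>lebesgue)"
    unfolding nn_integral_completion
    by (rule nn_integral_cong_AE) (use fh in eventually_elim, simp)
  finally show ?thesis .
qed

section \<open>Capacity and energy\<close>

lemma poisson_kernel_section_measurable:
  fixes \<mu> :: "((real ^ 'n) \<times> real) measure"
  assumes "sets \<mu> = sets borel"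
  shows "(\<lambda>zt. poisson_kernel \<alpha> (snd zt) (x - fst zt)) \<in> borel_measurable \<mu>"
  using measurable_compose[OF measurable_Pair2'[of x lborel \<mu>] poisson_kernel_measurable(1)[OF assms, of lborel \<alpha>]]
  by simp

text \<open>The majorant decays with exponent \<open>CARD('n) + \<alpha>\<close>; raised to the
  power \<open>q > 1\<close> this exceeds the dimension, so the majorant has an integrable
  \<open>q\<close>-th power.\<close>

lemma poisson_dominated_kernel:
  fixes K :: "((real ^ 'n) \<times> real) set"
  assumes "0 < \<alpha>" "compact K" "K \<subseteq> half_space" "1 < q"
  obtains B where
    "dominated_kernel K (\<lambda>zt x. poisson_kernel \<alpha> (snd zt) (x - fst zt)) lborel B q"
proof -
  let ?e = "real CARD('n) + \<alpha>"
  obtain D where D: "0 \<le> D" "\<And>zt x. zt \<in> K \<Longrightarrow>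
      poisson_kernel \<alpha> (snd zt) (x - fst zt) \<le> D * (1 + norm x) powr - ?e"
    using poisson_kernel_le[OF assms(1-3)] by blast
  define B where "B x = D * (1 + norm x) powr - ?e" for x :: "real ^ 'n"
  have [measurable]: "B \<in> borel_measurable borel"
    unfolding B_def by measurable
  show thesis
  proof
    show "dominated_kernel K (\<lambda>zt x. poisson_kernel \<alpha> (snd zt) (x - fst zt)) lborel B q"
    proof
      show "(\<lambda>(zt, x). poisson_kernel \<alpha> (snd zt) (x - fst zt)) \<in> borel_measurable (borel \<Otimes>\<^sub>M lborel)"
        by (rule poisson_kernel_measurable) auto
      show "0 \<le> poisson_kernel \<alpha> (snd zt) (x - fst zt)" if "zt \<in> K" for zt x
        using poisson_kernel_pos[OF assms(1), of "snd zt" "x - fst zt"] that assms(3)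
        by (auto simp: half_space_def intro: less_imp_le)
      show "integrable lborel (\<lambda>x. B x powr q)"
      proof (rule integrableI_nonneg)
        have eq: "B x powr q = D powr q * (1 + norm x) powr - (?e * q)" for x
          using D(1) by (simp add: B_def powr_mult powr_powr algebra_simps)
        have "real CARD('n) * 1 < ?e * q"
          using assms(1,4) by (intro mult_strict_mono) auto
        then have "(\<integral>\<^sup>+ x. ennreal ((1 + norm (x :: real ^ 'n)) powr - (?e * q)) \<partial>lborel) < \<infinity>"
          by (intro nn_integral_norm_powr_finite) simp
        then show "(\<integral>\<^sup>+ x. ennreal (B x powr q) \<partial>lborel) < \<infinity>"
          unfolding eq by (subst ennreal_mult) (simp_all add: nn_integral_cmult ennreal_mult_less_top)
      qed auto
    qed (use assms D in \<open>auto simp: B_def intro: poisson_kernel_continuous\<close>)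
  qed
qed

lemma emeasure_prob_on:
  fixes K :: "'a :: t2_space set"
  assumes "\<nu> \<in> prob_on K" "compact K"
  shows "emeasure \<nu> K = 1"
proof -
  interpret prob_space \<nu> using assms by (simp add: prob_on_def)
  have "K \<in> sets \<nu>" using assms by (simp add: prob_on_def borel_compact)
  then show ?thesis
    using AE_prob_on[OF assms(1) compact_imp_closed[OF assms(2)]] by (simp add: emeasure_eq_1_AE)
qed

lemma scale_prob_on_radon:
  fixes K :: "'a :: {second_countable_topology, complete_space} set"
  assumes "\<nu> \<in> prob_on K" "c < \<infinity>"
  shows "scale_measure c \<nu> \<in> radon_on K"
proof -
  interpret prob_space \<nu> using assms by (simp add: prob_on_def)
  have sets: "sets \<nu> = sets borel" using assms by (simp add: prob_on_def)
  have "emeasure \<nu> UNIV = 1" using emeasure_space_1 sets_eq_imp_space_eq[OF sets] by simp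
  with assms sets have "radon_measure (scale_measure c \<nu>)"
    by (intro finite_borel_radon) auto
  with assms show ?thesis by (simp add: radon_on_def prob_on_def)
qed

lemma poisson_adj_scale:
  fixes \<mu> :: "((real ^ 'n) \<times> real) measure"
  assumes "sets \<mu> = sets borel"
  shows "poisson_adj \<alpha> (scale_measure c \<mu>) x = c * poisson_adj \<alpha> \<mu> x"
proof -
  note [measurable] = poisson_kernel_section_measurable[OF assms]
  have [measurable]: "half_space \<in> sets \<mu>" using assms half_space_borel by simp
  show ?thesis
    unfolding poisson_adj_def by (rule nn_integral_scale_measure) measurable
qed

text \<open>The easy half of the duality: admissibility bounds the mass by the integral of the
  extension of \<open>f\<close>, Fubini moves the operator onto \<open>\<mu>\<close>, and Hoelder
  separates the two factors.\<close>

lemma capacity_duality_le: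
  fixes K :: "((real ^ 'n) \<times> real) set" and p q :: real
  assumes pq: "1 < p" "1 < q" "1 / p + 1 / q = 1"
    and K: "compact K" "K \<subseteq> half_space"
    and \<mu>: "\<mu> \<in> radon_on K" "Lp_norm q (poisson_adj \<alpha> \<mu>) \<le> 1"
    and f: "f \<in> borel_measurable lebesgue" "\<And>zt. zt \<in> K \<Longrightarrow> 1 \<le> poisson_ext \<alpha> f zt"
  shows "epowr (emeasure \<mu> K) p \<le> epowr (Lp_norm p f) p"
proof -
  have sets: "sets \<mu> = sets borel" and fin: "finite_measure \<mu>"
    using radon_on_finite_measure[OF \<mu>(1) K(1)] by auto
  have "emeasure \<mu> K = (\<integral>\<^sup>+ zt. indicator K zt \<partial>\<mu>)"
    using K sets by (simp add: borel_compact)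
  also have "\<dots> \<le> (\<integral>\<^sup>+ zt\<in>half_space. poisson_ext \<alpha> f zt \<partial>\<mu>)"
    using K(2) f(2) by (intro nn_integral_mono) (auto simp: indicator_def)
  also have "\<dots> = (\<integral>\<^sup>+ x. poisson_adj \<alpha> \<mu> x * f x \<partial>lebesgue)"
    by (rule poisson_Fubini[OF sets fin f(1)])
  finally have "epowr (emeasure \<mu> K) p \<le> epowr (\<integral>\<^sup>+ x. poisson_adj \<alpha> \<mu> x * f x \<partial>lebesgue) p"
    using pq by (intro epowr_mono) auto
  also have "\<dots> \<le> (\<integral>\<^sup>+ x. epowr (f x) p \<partial>lebesgue)"
  proof (rule epowr_Hoelder[OF pq _ f(1)])
    show "poisson_adj \<alpha> \<mu> \<in> borel_measurable lebesgue"
      using poisson_adj_measurable[OF sets fin] by (rule measurable_completion)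
    show "(\<integral>\<^sup>+ x. epowr (poisson_adj \<alpha> \<mu> x) q \<partial>lebesgue) \<le> 1"
      using \<mu>(2) pq by (simp add: Lp_norm_le_1_iff)
  qed
  also have "\<dots> = epowr (Lp_norm p f) p"
    using pq by (simp add: epowr_Lp_norm)
  finally show ?thesis .
qed

text \<open>Besides transferring the abstract minimiser, this gives \<open>A > 0\<close>, which
  allows division by \<open>A\<close> later: a strictly positive kernel has a strictly positive
  potential.\<close>

lemma poisson_energy_minimiser:
  fixes K :: "((real ^ 'n) \<times> real) set"
  assumes \<alpha>: "0 < \<alpha>" and K: "compact K" "K \<subseteq> half_space" "K \<noteq> {}" and q: "1 < q"
  obtains \<nu> g A where "\<nu> \<in> prob_on K" "g \<in> borel_measurable lborel" "\<And>x. 0 \<le> g x"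
    "\<And>x. poisson_adj \<alpha> \<nu> x = ennreal (g x)"
    "0 < A" "(\<integral>\<^sup>+ x. ennreal (g x powr q) \<partial>lborel) = ennreal A"
    "\<And>zt. zt \<in> K \<Longrightarrow> ennreal A \<le>
      (\<integral>\<^sup>+ x. ennreal (g x powr (q - 1) * poisson_kernel \<alpha> (snd zt) (x - fst zt)) \<partial>lborel)"
proof -
  let ?k = "\<lambda>zt x. poisson_kernel \<alpha> (snd zt) (x - fst zt)"
  obtain B where "dominated_kernel K ?k lborel B q"
    using poisson_dominated_kernel[OF \<alpha> K(1,2) q] by blast
  then interpret dominated_kernel K ?k lborel B q .
  obtain \<nu> where \<nu>: "\<nu> \<in> prob_on K" and min: "\<And>\<mu>. \<mu> \<in> prob_on K \<Longrightarrow> energy \<nu> \<le> energy \<mu>"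
    using energy_minimiser_exists[OF K(3)] by blast
  interpret \<nu>: prob_space \<nu> using \<nu> by (simp add: prob_on_def)
  have sets: "sets \<nu> = sets borel" using \<nu> by (simp add: prob_on_def)
  have AEK: "AE zt in \<nu>. zt \<in> K"
    by (rule AE_prob_on[OF \<nu> compact_imp_closed[OF K(1)]])
  have kpos: "0 < ?k zt x" if "zt \<in> K" for zt x
    using poisson_kernel_pos[OF \<alpha>, of "snd zt" "x - fst zt"] that K(2) by (auto simp: half_space_def)
  have adj: "poisson_adj \<alpha> \<nu> x = ennreal (potential \<nu> x)" for x
    unfolding poisson_adj_def ennreal_potential[OF \<nu>]
  proof (rule nn_integral_cong_AE)
    show "AE zt in \<nu>. ennreal (?k zt x) * indicator half_space zt = ennreal (indicator K zt * ?k zt x)"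
      using AEK by eventually_elim (use K(2) in auto)
  qed
  \<comment> \<open>If the potential vanished at \<open>x\<close>, the kernel would vanish almost
    everywhere on \<open>K\<close>, although it is positive there and \<open>K\<close> has full
    mass.\<close>
  have pos: "0 < potential \<nu> x" for x
  proof (rule ccontr)
    assume "\<not> 0 < potential \<nu> x"
    with potential_nonneg[OF \<nu>, of x] have "ennreal (potential \<nu> x) = 0" by simp
    then have "AE zt in \<nu>. ennreal (indicator K zt * ?k zt x) = 0"
      unfolding ennreal_potential[OF \<nu>]
      using measurable_compose[OF section_measurable[of x] measurable_ennreal]
      by (subst (asm) nn_integral_0_iff_AE) (simp_all add: measurable_cong_sets[OF sets refl])
    with AEK have "AE zt in \<nu>. False"
    proof eventually_elim
      case (elim zt)
      then show ?case using kpos[of zt x] by simp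
    qed
    then show False by simp
  qed
  define A where "A = (\<integral>x. potential \<nu> x powr q \<partial>lborel)"
  have energy: "(\<integral>\<^sup>+ x. ennreal (potential \<nu> x powr q) \<partial>lborel) = ennreal A"
    using energy_eq_integral[OF \<nu>] by (simp add: energy_def A_def)
  show thesis
  proof
    show "0 < A"
    proof (rule ccontr)
      assume "\<not> 0 < A"
      then have "(\<integral>\<^sup>+ x. ennreal (potential \<nu> x powr q) \<partial>lborel) = 0"
        unfolding energy by (simp add: ennreal_eq_0_iff)
      then have "AE x in lborel. ennreal (potential \<nu> x powr q) = 0"
        using potential_measurable[OF \<nu>] by (subst (asm) nn_integral_0_iff_AE) auto
      then have "AE x in (lborel :: (real ^ 'n) measure). False"
      proof eventually_elim
        case (elim x)
        moreover have "0 < potential \<nu> x powr q" using pos[of x] by simp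
        ultimately show ?case by simp
      qed
      then have "emeasure lborel (UNIV :: (real ^ 'n) set) = 0"
        by (subst (asm) AE_iff_measurable[where N = UNIV]) auto
      then show False by simp
    qed
    fix zt assume zt: "zt \<in> K"
    have "ennreal A \<le> ennreal (\<integral>x. potential \<nu> x powr (q - 1) * ?k zt x \<partial>lborel)"
      unfolding A_def by (intro ennreal_leI energy_minimiser_variation(2)[OF \<nu> min zt])
    also have "\<dots> = (\<integral>\<^sup>+ x. ennreal (potential \<nu> x powr (q - 1) * ?k zt x) \<partial>lborel)"
      by (intro nn_integral_eq_integral[symmetric] energy_minimiser_variation(1)[OF \<nu> min zt]
          AE_I2 mult_nonneg_nonneg powr_ge_zero less_imp_le[OF kpos[OF zt]])
    finally show "ennreal A \<le> (\<integral>\<^sup>+ x. ennreal (potential \<nu> x powr (q - 1) * ?k zt x) \<partial>lborel)" .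
  qed (use \<nu> energy adj potential_nonneg potential_measurable in auto)
qed

lemma Lp_capacity_le:
  fixes K :: "((real ^ 'n) \<times> real) set"
  assumes "0 < p" "f \<in> borel_measurable lebesgue" "\<And>x. 0 \<le> f x"
    "\<And>zt. zt \<in> K \<Longrightarrow> 1 \<le> poisson_ext \<alpha> (\<lambda>y. ennreal (f y)) zt"
  shows "Lp_capacity \<alpha> p K \<le> (\<integral>\<^sup>+ x. ennreal (f x powr p) \<partial>lebesgue)"
proof -
  have "Lp_capacity \<alpha> p K \<le> epowr (Lp_norm p (\<lambda>x. ennreal (f x))) p"
    unfolding Lp_capacity_def by (rule Inf_lower) (use assms in auto)
  also have "\<dots> = (\<integral>\<^sup>+ x. ennreal (f x powr p) \<partial>lebesgue)"
    using assms by (simp add: epowr_Lp_norm)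
  finally show ?thesis .
qed

lemma Lp_capacity_empty:
  assumes "0 < p"
  shows "Lp_capacity \<alpha> p {} = 0"
  using Lp_capacity_le[of p "\<lambda>_. 0" "{}" \<alpha>] assms by simp

text \<open>Fubini with the power of the adjoint itself as density. It holds for every finite Borel
  measure, and the identity \<open>a * epowr a (q - 1) = epowr a q\<close> persists at 0 and at
  infinity.\<close>

lemma poisson_ext_epowr_adj:
  fixes \<mu> :: "((real ^ 'n) \<times> real) measure"
  assumes "sets \<mu> = sets borel" "finite_measure \<mu>" "1 < q"
  shows "(\<integral>\<^sup>+ zt\<in>half_space. poisson_ext \<alpha> (\<lambda>x. epowr (poisson_adj \<alpha> \<mu> x) (q - 1)) zt \<partial>\<mu>)
      = (\<integral>\<^sup>+ x. epowr (poisson_adj \<alpha> \<mu> x) q \<partial>lebesgue)"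
proof -
  have "poisson_adj \<alpha> \<mu> \<in> borel_measurable lebesgue"
    using poisson_adj_measurable[OF assms(1,2)] by (rule measurable_completion)
  moreover have "a * epowr a (q - 1) = epowr a q" for a
  proof (cases a)
    case (real r)
    then show ?thesis
      using assms(3) by (cases "r = 0") (auto simp: powr_diff simp flip: ennreal_mult')
  qed (simp add: ennreal_top_mult)
  ultimately show ?thesis
    by (subst poisson_Fubini[OF assms(1,2)]) auto
qed

theorem proposition2p1:
  fixes K :: "((real ^ 'n) \<times> real) set" and p p' \<alpha> :: real
  assumes "1 < p" and "p' = p / (p - 1)"
    and "0 < \<alpha>" and "\<alpha> < 2"
    and "compact K" and "K \<subseteq> half_space"
  shows "Lp_capacity \<alpha> p K =
           Sup {epowr (emeasure \<mu> K) p | \<mu>. \<mu> \<in> radon_on K \<and> Lp_norm p' (poisson_adj \<alpha> \<mu>) \<le> 1}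
       \<and> (\<exists>\<mu>K \<in> radon_on K.
             emeasure \<mu>K K = (\<integral>\<^sup>+ x. epowr (poisson_adj \<alpha> \<mu>K x) p' \<partial>lebesgue)
           \<and> (\<integral>\<^sup>+ x. epowr (poisson_adj \<alpha> \<mu>K x) p' \<partial>lebesgue) =
             (\<integral>\<^sup>+ zt\<in>half_space. poisson_ext \<alpha> (\<lambda>x. epowr (poisson_adj \<alpha> \<mu>K x) (p' - 1)) zt \<partial>\<mu>K)
           \<and> (\<integral>\<^sup>+ zt\<in>half_space. poisson_ext \<alpha> (\<lambda>x. epowr (poisson_adj \<alpha> \<mu>K x) (p' - 1)) zt \<partial>\<mu>K) =
             Lp_capacity \<alpha> p K)"
    (is "_ = Sup ?S \<and> _")
proof (cases "K = {}")
  \<comment> \<open>The empty set carries no probability measure; here both sides are 0 and the null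
    measure is the witness.\<close>
  case True
  have "Sup ?S \<le> 0" using True by (intro Sup_least) auto
  moreover have "null_measure borel \<in> radon_on K"
    by (auto simp: radon_on_def intro!: finite_borel_radon)
  moreover have "poisson_adj \<alpha> (null_measure borel) x = 0" for x :: "real ^ 'n"
    by (simp add: poisson_adj_def)
  ultimately show ?thesis
    using assms(1) True by (auto simp: Lp_capacity_empty intro!: bexI[of _ "null_measure borel"])
next
  case False
  have q: "1 < p'" "1 / p + 1 / p' = 1" "(p' - 1) * p = p'" "(1 - p) * p' = - p" "- (p / p') = 1 - p"
    using assms(1) by (auto simp: assms(2) field_simps)
  obtain \<nu> g A where \<nu>: "\<nu> \<in> prob_on K" and g[measurable]: "g \<in> borel_measurable lborel"
    and g0: "\<And>x. 0 \<le> g x" and adj: "\<And>x. poisson_adj \<alpha> \<nu> x = ennreal (g x)"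
    and A: "0 < A" "(\<integral>\<^sup>+ x. ennreal (g x powr p') \<partial>lborel) = ennreal A"
    and var: "\<And>zt. zt \<in> K \<Longrightarrow> ennreal A \<le>
      (\<integral>\<^sup>+ x. ennreal (g x powr (p' - 1) * poisson_kernel \<alpha> (snd zt) (x - fst zt)) \<partial>lborel)"
    by (rule poisson_energy_minimiser[OF assms(3,5,6) False q(1)])
       (rule that, (assumption | fast)+)
  have sets: "sets \<nu> = sets borel" using \<nu> by (simp add: prob_on_def)
  define \<mu> where "\<mu> c = scale_measure (ennreal c) \<nu>" for c
  have radon: "\<mu> c \<in> radon_on K" for c
    unfolding \<mu>_def by (rule scale_prob_on_radon[OF \<nu>]) simp
  have mass: "emeasure (\<mu> c) K = ennreal c" for c
    using emeasure_prob_on[OF \<nu> assms(5)] by (simp add: \<mu>_def)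
  have norm: "(\<integral>\<^sup>+ x. epowr (poisson_adj \<alpha> (\<mu> c) x) p' \<partial>lebesgue) = ennreal (c powr p' * A)"
    if "0 \<le> c" for c
  proof -
    have "epowr (poisson_adj \<alpha> (\<mu> c) x) p' = ennreal (c powr p') * ennreal (g x powr p')" for x
      using that g0[of x]
      by (simp add: \<mu>_def poisson_adj_scale[OF sets] adj powr_mult flip: ennreal_mult)
    then show ?thesis
      using A by (simp add: nn_integral_completion nn_integral_cmult ennreal_mult)
  qed
  have upper: "Lp_capacity \<alpha> p K \<le> ennreal (A powr (1 - p))"
  proof -
    \<comment> \<open>Division by \<open>A\<close> turns the variational inequality into
      admissibility. Since \<open>(p' - 1) * p = p'\<close>, the \<open>p\<close>-th power of
      \<open>f\<close> integrates to \<open>A powr - p * A\<close>.\<close>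
    define f where "f x = g x powr (p' - 1) / A" for x
    have [measurable]: "f \<in> borel_measurable lborel" unfolding f_def by measurable
    have "1 \<le> poisson_ext \<alpha> (\<lambda>y. ennreal (f y)) zt" if "zt \<in> K" for zt
    proof -
      let ?k = "\<lambda>x. poisson_kernel \<alpha> (snd zt) (x - fst zt)"
      have [measurable]: "?k \<in> borel_measurable lborel"
        unfolding poisson_kernel_def by measurable
      have "poisson_ext \<alpha> (\<lambda>y. ennreal (f y)) zt
          = (\<integral>\<^sup>+ x. ennreal (1 / A) * ennreal (g x powr (p' - 1) * ?k x) \<partial>lborel)"
        unfolding poisson_ext_def case_prod_beta nn_integral_completion
      proof (rule nn_integral_cong)
        fix x
        have "poisson_kernel \<alpha> (snd zt) (fst zt - x) = ?k x"
          by (simp add: poisson_kernel_def norm_minus_commute)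
        moreover have "ennreal (?k x) * ennreal (f x) = ennreal (?k x * f x)"
          using A by (intro ennreal_mult''[symmetric]) (simp add: f_def)
        moreover have "ennreal (1 / A) * ennreal (g x powr (p' - 1) * ?k x)
            = ennreal (1 / A * (g x powr (p' - 1) * ?k x))"
          using A by (intro ennreal_mult'[symmetric]) simp
        ultimately show "ennreal (poisson_kernel \<alpha> (snd zt) (fst zt - x)) * ennreal (f x)
            = ennreal (1 / A) * ennreal (g x powr (p' - 1) * ?k x)"
          by (simp add: f_def mult_ac)
      qed
      also have "\<dots> = ennreal (1 / A) * (\<integral>\<^sup>+ x. ennreal (g x powr (p' - 1) * ?k x) \<partial>lborel)"
        by (rule nn_integral_cmult) measurable
      also have "\<dots> \<ge> ennreal (1 / A) * ennreal A"
        by (intro mult_left_mono var that) simp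
      also have "ennreal (1 / A) * ennreal A = 1"
        using A(1) by (simp flip: ennreal_mult)
      finally show ?thesis .
    qed
    then have "Lp_capacity \<alpha> p K \<le> (\<integral>\<^sup>+ x. ennreal (f x powr p) \<partial>lebesgue)"
      using assms(1) A(1) by (intro Lp_capacity_le) (auto simp: f_def measurable_completion)
    also have "\<dots> = (\<integral>\<^sup>+ x. ennreal (A powr - p) * ennreal (g x powr p') \<partial>lborel)"
    proof -
      have "f x powr p = A powr - p * g x powr p'" for x
        using A(1) by (simp add: f_def powr_divide powr_powr q(3) powr_minus_divide)
      then show ?thesis by (simp add: nn_integral_completion ennreal_mult)
    qed
    also have "\<dots> = ennreal (A powr - p * A)"
      using A by (simp add: nn_integral_cmult ennreal_mult)
    also have "A powr - p * A = A powr (1 - p)"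
      using A(1) powr_add[of A "- p" 1] by simp
    finally show ?thesis .
  qed
  have lower: "ennreal (A powr (1 - p)) \<le> Sup ?S"
  proof (rule Sup_upper)
    \<comment> \<open>The multiple is chosen so that the energy becomes exactly 1; the
      \<open>p\<close>-th power of its mass is then \<open>A powr (1 - p)\<close>, because
      \<open>p / p' = p - 1\<close>.\<close>
    let ?c = "A powr (- 1 / p')"
    have "?c powr p' = A powr - 1"
      using q(1) by (simp add: powr_powr)
    then have c: "?c powr p' * A = 1"
      using A(1) by (simp add: powr_minus)
    have "Lp_norm p' (poisson_adj \<alpha> (\<mu> ?c)) \<le> 1"
      using norm[of ?c, unfolded c] q(1) by (simp add: Lp_norm_le_1_iff)
    moreover have "epowr (emeasure (\<mu> ?c) K) p = ennreal (A powr (1 - p))"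
      using q(5) by (simp add: mass powr_powr)
    ultimately show "ennreal (A powr (1 - p)) \<in> ?S"
      using radon[of ?c] by (auto intro!: exI[of _ "\<mu> ?c"])
  qed
  have duality: "Sup ?S \<le> Lp_capacity \<alpha> p K"
    unfolding Lp_capacity_def
    using capacity_duality_le[OF assms(1) q(1,2) assms(5,6)]
    by (intro Sup_least Inf_greatest) fastforce
  have cap: "Lp_capacity \<alpha> p K = ennreal (A powr (1 - p))"
    using upper lower duality by (meson order_antisym order_trans)
  have sup: "Lp_capacity \<alpha> p K = Sup ?S"
    using upper lower duality by (meson order_antisym order_trans)
  \<comment> \<open>Now the multiple must have equal mass and energy, that is
    \<open>?c powr p' * A = ?c\<close>; this value solves the equation and is also the
    capacity.\<close>
  let ?c = "A powr (1 - p)"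
  have "?c powr p' = A powr - p" by (simp only: powr_powr q(4))
  then have c: "?c powr p' * A = ?c" using A(1) powr_add[of A "- p" 1] by simp
  have energy: "(\<integral>\<^sup>+ x. epowr (poisson_adj \<alpha> (\<mu> ?c) x) p' \<partial>lebesgue) = ennreal ?c"
    using norm[of ?c, unfolded c] by simp
  moreover have "(\<integral>\<^sup>+ zt\<in>half_space.
        poisson_ext \<alpha> (\<lambda>x. epowr (poisson_adj \<alpha> (\<mu> ?c) x) (p' - 1)) zt \<partial>\<mu> ?c) = ennreal ?c"
    using poisson_ext_epowr_adj[OF radon_on_finite_measure[OF radon assms(5)] q(1)]
      energy by simp
  ultimately show ?thesis
    using sup cap mass[of ?c] radon[of ?c] by (intro conjI bexI[of _ "\<mu> ?c"]) simp_all
qed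

end
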